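(* There is an absolute constant $c>0$ such that for all sufficiently large $n$ the following holds. Let $Q_1,\dots,Q_n\colon\mathbb{F}_2^m\to\mathbb{F}_2$ be polynomials of degree at most $2$, and let $\mathcal{Q}$ be the distribution of $(Q_1(X),\dots,Q_n(X))$ for $X$ uniform on $\mathbb{F}_2^m$. Then \[ \|\mathcal{Q}-\mathrm{Ber}(1/3)^{\otimes n}\|_{\mathtt{TV}}\ \ge\ 1-n^{-c/\log\log n}. \]
   Context: Logarithms are base 2. Total variation distance: $\|\mathcal{D}_1-\mathcal{D}_2\|_{\mathtt{TV}}=\frac12\sum_x|\mathcal{D}_1(x)-\mathcal{D}_2(x)|$; $\mathrm{Ber}(1/3)^{\otimes n}$ is the product of $n$ independent Bernoulli$(1/3)$ bits. *)

theory Defs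
  imports Complex_Main
begin

text \<open>Points of F_2^k: boolean vectors indexed by {0..<k}, zero outside.\<close>
definition cube :: "nat \<Rightarrow> (nat \<Rightarrow> bool) set" where
  "cube k = {x. \<forall>i. k \<le> i \<longrightarrow> \<not> x i}"

text \<open>Evaluation (in F_2, True = 1) of the polynomial
  c + sum_i a_i x_i + sum_{i<j} b_ij x_i x_j over F_2 in m variables.\<close>
definition quad_eval :: "nat \<Rightarrow> bool \<Rightarrow> (nat \<Rightarrow> bool) \<Rightarrow> (nat \<Rightarrow> nat \<Rightarrow> bool)
    \<Rightarrow> (nat \<Rightarrow> bool) \<Rightarrow> bool" where
  "quad_eval m c a b x =
     odd (of_bool c + (\<Sum>i<m. of_bool (a i \<and> x i))
          + (\<Sum>i<m. \<Sum>j\<in>{i<..<m}. of_bool (b i j \<and> x i \<and> x j)) :: nat)"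

definition deg_le2 :: "nat \<Rightarrow> ((nat \<Rightarrow> bool) \<Rightarrow> bool) \<Rightarrow> bool" where
  "deg_le2 m f \<longleftrightarrow> (\<exists>c a b. \<forall>x\<in>cube m. f x = quad_eval m c a b x)"

definition distQ :: "nat \<Rightarrow> nat \<Rightarrow> (nat \<Rightarrow> (nat \<Rightarrow> bool) \<Rightarrow> bool) \<Rightarrow> (nat \<Rightarrow> bool) \<Rightarrow> real" where
  "distQ m n Q y = real (card {x\<in>cube m. \<forall>i<n. Q i x = y i}) / 2 ^ m"

definition ber13 :: "nat \<Rightarrow> (nat \<Rightarrow> bool) \<Rightarrow> real" where
  "ber13 n y = (\<Prod>i<n. if y i then 1/3 else 2/3)"

definition tv_dist :: "nat \<Rightarrow> ((nat \<Rightarrow> bool) \<Rightarrow> real) \<Rightarrow> ((nat \<Rightarrow> bool) \<Rightarrow> real) \<Rightarrow> real" where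
  "tv_dist n P R = (1/2) * (\<Sum>y\<in>cube n. \<bar>P y - R y\<bar>)"

end

theory Submission
  imports Defs "HOL-Library.Z2" "HOL-Library.Function_Algebras" "HOL-Real_Asymp.Real_Asymp"
begin

text \<open>
  Write \<open>TV = 1 - overlap\<close>, where the overlap of two distributions is the sum of their pointwise
  minima. It is subadditive, does not decrease when passing to a subset of the outputs, and is at
  most \<open>\<rho> ^ s\<close> for the product of Bernoulli(1/3) bits against a product of \<open>s\<close> bits with
  probabilities bounded away from 1/3. A quadratic polynomial on a coset of a subgroup has bias
  \<open>b\<close> with \<open>b\<^sup>2 = 0\<close> or \<open>b\<^sup>2 = 2 ^ (- k)\<close>, so it is never close to a Bernoulli(1/3) bit.

  Fix \<open>t\<close> of order \<open>log n / log log n\<close> and take a maximal set \<open>J\<close> of at most \<open>t\<close> outputs all of whose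
  nonempty sums have rank above \<open>2 t\<close>. If \<open>J\<close> has \<open>t\<close> elements, these outputs are almost uniform
  and independent. Otherwise every output is a sum over a subset of \<open>J\<close> plus a polynomial of rank
  \<open>O(t)\<close>, and by pigeonhole \<open>n / 2 ^ t\<close> outputs share the same sum \<open>P\<close>, which can be dropped at the
  cost of a factor 2. For outputs of rank at most \<open>r\<close>, shrink the space in at most \<open>r\<close> rounds: either
  there are many more independent outputs on the cosets of the current subgroup than its
  codimension, or fixing all linear forms of a maximal independent family lowers the rank of every
  output. The codimension grows by a factor \<open>O(r)\<close> per round, so that \<open>r ^ O(r) \<le> n\<close> is needed.
\<close>

subsection \<open>Elementary abelian 2-groups\<close>

text \<open>Subspaces over F_2: exponent 2 makes scalars and inverses automatic. Codimension appears
  throughout as an index, \<open>card G \<le> 2 ^ w * card K\<close>.\<close>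

definition el2_group :: "'a::ab_group_add set \<Rightarrow> bool" where
  "el2_group A \<longleftrightarrow> finite A \<and> 0 \<in> A \<and> (\<forall>x\<in>A. \<forall>y\<in>A. x + y \<in> A) \<and> (\<forall>x\<in>A. x + x = 0)"

lemma el2_groupD:
  assumes "el2_group A"
  shows "finite A" "0 \<in> A" "\<And>x y. x \<in> A \<Longrightarrow> y \<in> A \<Longrightarrow> x + y \<in> A"
    "\<And>x. x \<in> A \<Longrightarrow> x + x = 0" "card A > 0"
  using assms by (auto simp: el2_group_def card_gt_0_iff)

lemma el2_group_add_add:
  assumes "el2_group A" "x \<in> A"
  shows "x + (x + y) = y"
  using el2_groupD(4)[OF assms] by (metis add.assoc add.left_neutral)

lemma el2_group_add_mem_iff:
  assumes "el2_group A" "x \<in> A"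
  shows "x + y \<in> A \<longleftrightarrow> y \<in> A"
  using el2_groupD(3)[OF assms(1)] el2_group_add_add[OF assms] assms(2) by metis

lemma el2_group_Int:
  assumes "el2_group A" "el2_group B"
  shows "el2_group (A \<inter> B)"
  using assms by (auto simp: el2_group_def)

lemma el2_group_set_plus:
  assumes "el2_group G" "el2_group A" "el2_group B" "A \<subseteq> G" "B \<subseteq> G"
  shows "el2_group {a + b |a b. a \<in> A \<and> b \<in> B}"
proof -
  let ?M = "{a + b |a b. a \<in> A \<and> b \<in> B}"
  note A = el2_groupD[OF assms(2)] and B = el2_groupD[OF assms(3)]
  have "?M \<subseteq> G"
    using assms(4,5) el2_groupD(3)[OF assms(1)] by blast
  moreover have "0 \<in> ?M" using A(2) B(2) by force
  moreover have "x + y \<in> ?M" if xy: "x \<in> ?M" "y \<in> ?M" for x y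
  proof -
    from xy obtain a b a' b' where "x = a + b" "y = a' + b'" "a \<in> A" "b \<in> B" "a' \<in> A" "b' \<in> B"
      by blast
    then have "x + y = (a + a') + (b + b')" "a + a' \<in> A" "b + b' \<in> B"
      using A(3) B(3) by (auto simp: algebra_simps)
    then show ?thesis by blast
  qed
  ultimately show ?thesis
    using el2_groupD(1,4)[OF assms(1)] finite_subset unfolding el2_group_def by blast
qed

lemma el2_group_sum_translate:
  fixes \<phi> :: "'a::ab_group_add \<Rightarrow> real"
  assumes "el2_group K" "a \<in> K"
  shows "(\<Sum>x\<in>K. \<phi> (x + a)) = (\<Sum>x\<in>K. \<phi> x)"
proof (rule sum.reindex_bij_witness[where i = "\<lambda>x. x + a" and j = "\<lambda>x. x + a"])
qed (use assms el2_groupD(3)[OF assms(1)] el2_groupD(4)[OF assms] in \<open>auto simp: add.assoc\<close>)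

text \<open>Adjoining some \<open>b\<close> outside \<open>K\<close> doubles \<open>K\<close>, and
  each coset of the larger group is the union of the cosets of \<open>K\<close> through
  \<open>t\<close> and \<open>t + b\<close>; the induction is on
  \<open>card (G - K)\<close>.\<close>

lemma el2_group_transversal:
  assumes "el2_group G" "el2_group K" "K \<subseteq> G"
  shows "\<exists>k T. T \<subseteq> G \<and> card T \<le> 2 ^ k \<and> card G = 2 ^ k * card K \<and>
      G = (\<Union>t\<in>T. (\<lambda>x. t + x) ` K)"
  using assms(2,3)
proof (induction "card (G - K)" arbitrary: K rule: less_induct)
  case less
  note G = el2_groupD[OF assms(1)] and K = el2_groupD[OF less.prems(1)]
  show ?case
  proof (cases "K = G")
    case True
    then show ?thesis
      using G(2) by (intro exI[of _ 0] exI[of _ "{0}"]) auto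
  next
    case False
    then obtain b where b: "b \<in> G" "b \<notin> K" using less.prems(2) by blast
    define K' where "K' = K \<union> (\<lambda>x. b + x) ` K"
    have sub: "K' \<subseteq> G" using less.prems(2) b G(3) by (auto simp: K'_def)
    have bK: "b + x + (b + y) = x + y" for x y
    proof -
      have "b + x + (b + y) = (b + b) + (x + y)" by (simp add: algebra_simps)
      then show ?thesis using G(4)[OF b(1)] by simp
    qed
    have sg: "el2_group K'"
      unfolding el2_group_def
    proof (intro conjI ballI)
      show "finite K'" "0 \<in> K'" using K(1,2) by (auto simp: K'_def)
      show "x + x = 0" if "x \<in> K'" for x using that sub G(4) by blast
      fix x y assume "x \<in> K'" "y \<in> K'"
      then consider "x \<in> K" "y \<in> K" | u where "x = b + u" "u \<in> K" "y \<in> K"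
        | v where "x \<in> K" "v \<in> K" "y = b + v" | u v where "x = b + u" "u \<in> K" "v \<in> K" "y = b + v"
        by (auto simp: K'_def)
      then show "x + y \<in> K'"
      proof cases
        case 3
        then have "x + y = b + (x + v)" by (simp add: algebra_simps)
        then show ?thesis using 3 K(3) by (auto simp: K'_def)
      next
        case 4
        then show ?thesis unfolding K'_def 4(1,4) bK using K(3) by blast
      qed (use K(3) in \<open>auto simp: K'_def add.assoc\<close>)
    qed
    have disj: "K \<inter> (\<lambda>x. b + x) ` K = {}"
      using b(2) el2_group_add_mem_iff[OF less.prems(1)] by (auto simp: add.commute)
    have card: "card K' = 2 * card K"
      unfolding K'_def using K(1) disj by (subst card_Un_disjoint) (auto simp: card_image)
    have "b \<in> K'" using K(2) by (force simp: K'_def)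
    then have "card (G - K') < card (G - K)"
      using b G(1) by (intro psubset_card_mono) (auto simp: K'_def)
    from less.hyps[OF this sg sub] obtain k T where
      T: "T \<subseteq> G" "card T \<le> 2 ^ k" "card G = 2 ^ k * card K'" "G = (\<Union>t\<in>T. (\<lambda>x. t + x) ` K')"
      by blast
    define T' where "T' = T \<union> (\<lambda>t. t + b) ` T"
    have "finite T" using T(1) G(1) finite_subset by blast
    then have "card T' \<le> 2 ^ Suc k"
      using card_Un_le[of T "(\<lambda>t. t + b) ` T"] card_image_le[of T "\<lambda>t. t + b"] T(2)
      by (simp add: T'_def)
    moreover have "card G = 2 ^ Suc k * card K" using T(3) card by simp
    moreover have "T' \<subseteq> G" using T(1) b G(3) by (auto simp: T'_def)
    moreover have "G = (\<Union>t\<in>T'. (\<lambda>x. t + x) ` K)"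
    proof -
      have "(\<lambda>x. t + x) ` K' = (\<lambda>x. t + x) ` K \<union> (\<lambda>x. t + b + x) ` K" for t
        by (simp add: K'_def image_Un image_image add.assoc)
      then show ?thesis unfolding T(4) T'_def by auto
    qed
    ultimately show ?thesis by blast
  qed
qed

text \<open>The dimension formula: the fibre of addition through \<open>(a, b)\<close> consists of
  the pairs \<open>(a + c, b + c)\<close> with \<open>c\<close> in \<open>A \<inter> B\<close>,
  because \<open>c + c = 0\<close>.\<close>

lemma el2_group_card_set_plus:
  assumes A: "el2_group A" and B: "el2_group B"
  shows "card {a + b |a b. a \<in> A \<and> b \<in> B} * card (A \<inter> B) = card A * card B"
proof -
  let ?M = "{a + b |a b. a \<in> A \<and> b \<in> B}"
  let ?g = "\<lambda>(a, b). a + b"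
  let ?fib = "\<lambda>m. {p \<in> A \<times> B. ?g p = m}"
  have fin: "finite A" "finite B" using el2_groupD(1) A B by auto
  have M: "?g ` (A \<times> B) = ?M" by auto
  have fib: "card (?fib m) = card (A \<inter> B)" if "m \<in> ?M" for m
  proof -
    from that obtain a b where ab: "m = a + b" "a \<in> A" "b \<in> B" by blast
    have "bij_betw (\<lambda>c. (a + c, b + c)) (A \<inter> B) (?fib m)"
    proof (rule bij_betw_byWitness[where f' = "\<lambda>(x, y). a + x"])
      show "\<forall>c\<in>A \<inter> B. (case (a + c, b + c) of (x, y) \<Rightarrow> a + x) = c"
        using el2_group_add_add[OF A ab(2)] by auto
      have key: "b + (a + x) = y \<and> a + x \<in> B" if "x \<in> A" "y \<in> B" "x + y = m" for x y
      proof -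
        have "b + (a + x) = x + m" by (simp add: ab algebra_simps)
        also have "\<dots> = y" using that el2_group_add_add[OF A] by blast
        finally show ?thesis using el2_group_add_mem_iff[OF B ab(3)] that by auto
      qed
      show "\<forall>p\<in>?fib m. (\<lambda>c. (a + c, b + c)) (case p of (x, y) \<Rightarrow> a + x) = p"
        using key el2_group_add_add[OF A ab(2)] by auto
      show "(\<lambda>c. (a + c, b + c)) ` (A \<inter> B) \<subseteq> ?fib m"
      proof -
        have "a + c + (b + c) = a + b" if "c \<in> A" for c
        proof -
          have "a + c + (b + c) = (a + b) + (c + c)" by (simp add: algebra_simps)
          then show ?thesis using el2_groupD(4)[OF A that] by simp
        qed
        then show ?thesis using ab el2_groupD(3)[OF A] el2_groupD(3)[OF B] by auto
      qed
      show "(\<lambda>(x, y). a + x) ` ?fib m \<subseteq> A \<inter> B"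
        using key el2_groupD(3)[OF A] ab by auto
    qed
    from bij_betw_same_card[OF this] show ?thesis by (rule sym)
  qed
  have "card A * card B = card (A \<times> B)" by (simp add: card_cartesian_product)
  also have "\<dots> = (\<Sum>m\<in>?M. card (?fib m))"
    using fin sum.image_gen[of "A \<times> B" "\<lambda>_. 1::nat" ?g] unfolding M by simp
  also have "\<dots> = card ?M * card (A \<inter> B)" using fib by simp
  finally show ?thesis by simp
qed

section \<open>Averages and the product rule for functions with complementary periods\<close>

definition avg :: "'a set \<Rightarrow> ('a \<Rightarrow> real) \<Rightarrow> real" where
  "avg K \<phi> = (\<Sum>x\<in>K. \<phi> x) / real (card K)"

text \<open>Summing \<open>\<psi>\<close> over the translates by \<open>A\<close> gives a
  \<open>\<theta>\<close> that is constant on \<open>K\<close>: shifts by \<open>A\<close> permute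
  the summands and shifts by \<open>B\<close> preserve \<open>\<psi>\<close>. Against an
  \<open>A\<close>-invariant factor \<open>\<theta>\<close> acts as \<open>card A\<close> times
  \<open>\<psi>\<close>; this is applied to \<open>\<phi>\<close> and to the constant 1.\<close>

lemma avg_mult_transversal:
  assumes A: "el2_group A" and B: "el2_group B" and K: "el2_group K"
    and sum: "K = {a + b |a b. a \<in> A \<and> b \<in> B}"
    and invA: "\<And>x a. x \<in> K \<Longrightarrow> a \<in> A \<Longrightarrow> \<phi> (x + a) = \<phi> x"
    and invB: "\<And>x b. x \<in> K \<Longrightarrow> b \<in> B \<Longrightarrow> \<psi> (x + b) = \<psi> x"
  shows "avg K (\<lambda>x. \<phi> x * \<psi> x) = avg K \<phi> * avg K \<psi>"
proof -
  have AK: "A \<subseteq> K" and BK: "B \<subseteq> K"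
    unfolding sum using el2_groupD(2)[OF A] el2_groupD(2)[OF B] by force+
  note cK = el2_groupD(5)[OF K] and cA = el2_groupD(5)[OF A]
  define \<theta> where "\<theta> x = (\<Sum>a\<in>A. \<psi> (x + a))" for x
  have \<theta>: "\<theta> x = \<theta> 0" if "x \<in> K" for x
  proof -
    from that obtain a b where ab: "x = a + b" "a \<in> A" "b \<in> B" unfolding sum by blast
    have "\<theta> x = (\<Sum>c\<in>A. \<psi> ((c + a) + b))" by (simp add: \<theta>_def ab algebra_simps)
    also have "\<dots> = (\<Sum>c\<in>A. \<psi> (c + a))"
      using ab AK el2_groupD(3)[OF K] by (intro sum.cong refl invB) auto
    also have "\<dots> = \<theta> 0" using el2_group_sum_translate[OF A ab(2), of \<psi>] by (simp add: \<theta>_def)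
    finally show ?thesis .
  qed
  have sw: "(\<Sum>x\<in>K. \<phi> x * \<theta> x) = real (card A) * (\<Sum>x\<in>K. \<phi> x * \<psi> x)" if
    inv: "\<And>x a. x \<in> K \<Longrightarrow> a \<in> A \<Longrightarrow> \<phi> (x + a) = \<phi> x" for \<phi> :: "_ \<Rightarrow> real"
  proof -
    have "(\<Sum>x\<in>K. \<phi> x * \<theta> x) = (\<Sum>a\<in>A. \<Sum>x\<in>K. \<phi> x * \<psi> (x + a))"
      unfolding \<theta>_def sum_distrib_left by (rule sum.swap)
    also have "\<dots> = (\<Sum>a\<in>A. \<Sum>x\<in>K. \<phi> (x + a) * \<psi> (x + a))"
      by (intro sum.cong refl) (auto simp: inv)
    also have "\<dots> = (\<Sum>a\<in>A. \<Sum>x\<in>K. \<phi> x * \<psi> x)"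
      using AK by (intro sum.cong refl el2_group_sum_translate[OF K]) auto
    finally show ?thesis by simp
  qed
  have "real (card A) * (\<Sum>x\<in>K. \<phi> x * \<psi> x) = (\<Sum>x\<in>K. \<phi> x) * \<theta> 0"
    using sw[of \<phi>] invA \<theta> by (simp add: sum_distrib_right)
  moreover have "real (card A) * (\<Sum>x\<in>K. \<psi> x) = real (card K) * \<theta> 0"
    using sw[of "\<lambda>_. 1"] \<theta> by simp
  ultimately have "real (card A) * ((\<Sum>x\<in>K. \<phi> x * \<psi> x) * card K) =
      real (card A) * ((\<Sum>x\<in>K. \<phi> x) * (\<Sum>x\<in>K. \<psi> x))"
    by algebra
  then show ?thesis
    using cA cK by (simp add: avg_def field_simps)
qed

subsection \<open>Quadratic functions and their biases\<close>

text \<open>Otherwise the simplifier turns the field operations of \<open>bit\<close> into bitwise ones.\<close>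

declare add_bit_eq_xor [simp del] mult_bit_eq_and [simp del]

definition chi :: "bit \<Rightarrow> real" where
  "chi b = (if b = 0 then 1 else - 1)"

lemma chi_0 [simp]: "chi 0 = 1" and chi_1 [simp]: "chi 1 = - 1"
  by (simp_all add: chi_def)

lemma chi_add: "chi (a + b) = chi a * chi b"
  by (cases a; cases b) simp_all

lemma chi_sum: "finite A \<Longrightarrow> chi (\<Sum>i\<in>A. f i) = (\<Prod>i\<in>A. chi (f i))"
  by (induction A rule: finite_induct) (auto simp: chi_add)

lemma bit_add_self [simp]: "a + a = (0::bit)"
  by (cases a) simp_all

lemma bit_add_add_self [simp]: "a + (a + b) = (b::bit)"
  by (cases a; cases b) simp_all

lemma bit_add_eq_0_iff: "a + b = 0 \<longleftrightarrow> a = (b::bit)"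
  by (cases a; cases b) simp_all

text \<open>Orthogonality of characters: translating by a point where \<open>g\<close> is 1 flips
  every sign.\<close>

lemma sum_chi_additive:
  assumes K: "el2_group K" and g: "\<And>x y. x \<in> K \<Longrightarrow> y \<in> K \<Longrightarrow> g (x + y) = g x + g y"
  shows "(\<Sum>x\<in>K. chi (g x)) = (if \<forall>x\<in>K. g x = 0 then real (card K) else 0)"
proof (cases "\<forall>x\<in>K. g x = 0")
  case False
  then obtain a where a: "a \<in> K" "g a = 1" by auto
  have "(\<Sum>x\<in>K. chi (g x)) = (\<Sum>x\<in>K. chi (g (x + a)))"
    using el2_group_sum_translate[OF K a(1), of "\<lambda>x. chi (g x)"] by simp
  also have "\<dots> = (\<Sum>x\<in>K. - chi (g x))"
    by (intro sum.cong refl) (simp add: g a chi_add)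
  also have "\<dots> = - (\<Sum>x\<in>K. chi (g x))" by (simp add: sum_negf)
  finally show ?thesis using False by auto
qed simp

text \<open>Degree at most 2, expressed by the vanishing of all third differences.\<close>

definition quad_on :: "'a::ab_group_add set \<Rightarrow> ('a \<Rightarrow> bit) \<Rightarrow> bool" where
  "quad_on G f \<longleftrightarrow> (\<forall>t\<in>G. \<forall>x\<in>G. \<forall>y\<in>G. \<forall>z\<in>G.
     f (t + x + y + z) + f (t + x + y) + f (t + x + z) + f (t + y + z)
     + f (t + x) + f (t + y) + f (t + z) + f t = 0)"

lemma quad_on_subset: "quad_on G f \<Longrightarrow> K \<subseteq> G \<Longrightarrow> quad_on K f"
  unfolding quad_on_def by blast

lemma quad_on_translate:
  assumes "el2_group G" "quad_on G f" "t \<in> G"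
  shows "quad_on G (\<lambda>x. f (t + x))"
  unfolding quad_on_def
proof (intro ballI)
  fix s x y z assume G: "s \<in> G" "x \<in> G" "y \<in> G" "z \<in> G"
  have "t + s \<in> G" using el2_groupD(3)[OF assms(1,3)] G by blast
  with G assms(2) have
    "f (t + s + x + y + z) + f (t + s + x + y) + f (t + s + x + z) + f (t + s + y + z)
     + f (t + s + x) + f (t + s + y) + f (t + s + z) + f (t + s) = 0"
    unfolding quad_on_def by blast
  then show "f (t + (s + x + y + z)) + f (t + (s + x + y)) + f (t + (s + x + z))
      + f (t + (s + y + z)) + f (t + (s + x)) + f (t + (s + y)) + f (t + (s + z)) + f (t + s) = 0"
    by (simp only: add.assoc)
qed

lemma quad_on_add:
  assumes "quad_on G f" "quad_on G g"
  shows "quad_on G (\<lambda>x. f x + g x)"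
  unfolding quad_on_def
proof (intro ballI)
  fix t x y z assume G: "t \<in> G" "x \<in> G" "y \<in> G" "z \<in> G"
  let ?D = "\<lambda>f. f (t + x + y + z) + f (t + x + y) + f (t + x + z) + f (t + y + z)
     + f (t + x) + f (t + y) + f (t + z) + f t"
  have "?D f = 0" "?D g = 0"
    using assms G unfolding quad_on_def by blast+
  moreover have "?D (\<lambda>x. f x + g x) = ?D f + ?D g"
    by (simp only: ac_simps)
  ultimately show "?D (\<lambda>x. f x + g x) = 0" by (simp only: add_0)
qed

lemma quad_on_const: "quad_on G (\<lambda>_. c)"
  unfolding quad_on_def by (cases c) auto

lemma quad_on_sum:
  assumes "finite A" "\<And>i. i \<in> A \<Longrightarrow> quad_on G (f i)"
  shows "quad_on G (\<lambda>x. \<Sum>i\<in>A. f i x)"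
  using assms by (induction A rule: finite_induct) (auto intro: quad_on_add quad_on_const)

section \<open>Polar form, radical and the squared bias\<close>

definition radical :: "'a::ab_group_add set \<Rightarrow> ('a \<Rightarrow> bit) \<Rightarrow> 'a set" where
  "radical K f = {h \<in> K. \<forall>y\<in>K. f (h + y) + f h + f y + f 0 = 0}"

text \<open>The third difference at base point 0 is the additivity defect of the polar form
  \<open>f (h + y) + f h + f y + f 0\<close>; its last term allows for a constant term in
  \<open>f\<close>.\<close>

lemma quad_on_polar_add:
  assumes "el2_group K" "quad_on K f" "h \<in> K" "x \<in> K" "y \<in> K"
  shows "f (h + (x + y)) + f h + f (x + y) + f 0
    = (f (h + x) + f h + f x + f 0) + (f (h + y) + f h + f y + f 0)"
proof -
  have "f (0 + h + x + y) + f (0 + h + x) + f (0 + h + y) + f (0 + x + y)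
      + f (0 + h) + f (0 + x) + f (0 + y) + f 0 = 0"
    using assms(2-5) el2_groupD(2)[OF assms(1)] unfolding quad_on_def by blast
  then have "f (h + x + y) + f (h + x) + f (h + y) + f (x + y) + f h + f x + f y + f 0 = 0"
    by (simp only: add_0)
  then have "f (h + (x + y)) = f (h + x) + f (h + y) + f (x + y) + f h + f x + f y + f 0"
    by (simp add: add.assoc bit_add_eq_0_iff)
  then show ?thesis by (simp add: ac_simps)
qed

lemma el2_group_radical:
  assumes K: "el2_group K" and f: "quad_on K f"
  shows "el2_group (radical K f)"
proof -
  have "a + b \<in> radical K f" if "a \<in> radical K f" "b \<in> radical K f" for a b
  proof -
    from that have ab: "a \<in> K" "b \<in> K" by (auto simp: radical_def)
    have "f (a + b + y) + f (a + b) + f y + f 0 = 0" if y: "y \<in> K" for y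
    proof -
      have "f (y + a) + f y + f a + f 0 = 0" "f (y + b) + f y + f b + f 0 = 0"
        using \<open>a \<in> radical K f\<close> \<open>b \<in> radical K f\<close> y by (auto simp: radical_def ac_simps)
      then have "f (y + (a + b)) + f y + f (a + b) + f 0 = 0"
        using quad_on_polar_add[OF K f y ab] by simp
      then show ?thesis by (simp add: ac_simps)
    qed
    then show ?thesis using ab el2_groupD(3)[OF K] by (auto simp: radical_def)
  qed
  moreover have "0 \<in> radical K f"
    using el2_groupD(2)[OF K] by (auto simp: radical_def ac_simps)
  ultimately show ?thesis
    using el2_groupD(1,4)[OF K] by (auto simp: el2_group_def radical_def)
qed

text \<open>Squaring and substituting \<open>y = h + x\<close> leaves, for each \<open>h\<close>,
  the character sum of the polar form with \<open>h\<close>. That form is additive in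
  \<open>x\<close>, so only \<open>h\<close> in the radical contribute.\<close>

lemma sum_chi_quad_square:
  assumes K: "el2_group K" and f: "quad_on K f"
  shows "(\<Sum>x\<in>K. chi (f x))\<^sup>2 = real (card K) * (\<Sum>h\<in>radical K f. chi (f h + f 0))"
proof -
  have "(\<Sum>x\<in>K. chi (f x))\<^sup>2 = (\<Sum>x\<in>K. chi (f x) * (\<Sum>y\<in>K. chi (f y)))"
    by (simp add: power2_eq_square sum_distrib_right)
  also have "\<dots> = (\<Sum>x\<in>K. chi (f x) * (\<Sum>h\<in>K. chi (f (h + x))))"
    by (intro sum.cong refl arg_cong2[where f = "(*)"] el2_group_sum_translate[OF K, symmetric])
  also have "\<dots> = (\<Sum>x\<in>K. \<Sum>h\<in>K. chi (f x) * chi (f (h + x)))"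
    by (simp add: sum_distrib_left)
  also have "\<dots> = (\<Sum>h\<in>K. \<Sum>x\<in>K. chi (f x) * chi (f (h + x)))"
    by (rule sum.swap)
  also have "\<dots> = (\<Sum>h\<in>K. chi (f h + f 0) * (\<Sum>x\<in>K. chi (f (h + x) + f h + f x + f 0)))"
    unfolding sum_distrib_left
    by (intro sum.cong refl) (simp add: chi_add[symmetric] ac_simps)
  also have "\<dots> = (\<Sum>h\<in>K. chi (f h + f 0) * (if h \<in> radical K f then real (card K) else 0))"
  proof (intro sum.cong refl arg_cong2[where f = "(*)"])
    fix h assume h: "h \<in> K"
    have "(\<Sum>x\<in>K. chi (f (h + x) + f h + f x + f 0)) =
        (if \<forall>x\<in>K. f (h + x) + f h + f x + f 0 = 0 then real (card K) else 0)"
      by (rule sum_chi_additive[OF K]) (rule quad_on_polar_add[OF K f h])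
    then show "(\<Sum>x\<in>K. chi (f (h + x) + f h + f x + f 0)) =
        (if h \<in> radical K f then real (card K) else 0)"
      using h by (simp only: radical_def mem_Collect_eq simp_thms)
  qed
  also have "\<dots> = (\<Sum>h\<in>K \<inter> radical K f. chi (f h + f 0) * real (card K))"
    using el2_groupD(1)[OF K] by (simp add: sum.inter_restrict if_distrib cong: if_cong)
  also have "K \<inter> radical K f = radical K f" by (auto simp: radical_def)
  finally show ?thesis by (simp add: sum_distrib_left mult.commute)
qed

lemma avg_chi_quad_square_le:
  assumes K: "el2_group K" and f: "quad_on K f"
  shows "(avg K (\<lambda>x. chi (f x)))\<^sup>2 \<le> real (card (radical K f)) / real (card K)"
proof -
  have "(\<Sum>h\<in>radical K f. chi (f h + f 0)) \<le> (\<Sum>h\<in>radical K f. 1)"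
    by (intro sum_mono) (simp add: chi_def)
  then show ?thesis
    using el2_groupD(5)[OF K]
    by (simp add: avg_def power_divide sum_chi_quad_square[OF K f])
      (simp add: power2_eq_square divide_right_mono)
qed

text \<open>On the radical \<open>f + f 0\<close> is additive, so its character sum is 0 or full. In
  the second case the squared bias is the inverse index of the radical, a power of two.\<close>

lemma avg_chi_quad_square:
  assumes K: "el2_group K" and f: "quad_on K f"
  shows "(avg K (\<lambda>x. chi (f x)))\<^sup>2 = 0 \<or> (\<exists>k. (avg K (\<lambda>x. chi (f x)))\<^sup>2 = 1 / 2 ^ k)"
proof -
  let ?R = "radical K f"
  have R: "el2_group ?R" by (rule el2_group_radical[OF K f])
  have RK: "?R \<subseteq> K" by (auto simp: radical_def)
  have "(\<Sum>h\<in>?R. chi (f h + f 0)) =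
      (if \<forall>h\<in>?R. f h + f 0 = 0 then real (card ?R) else 0)"
  proof (rule sum_chi_additive[OF R])
    fix x y assume "x \<in> ?R" "y \<in> ?R"
    then have "f (x + y) + (f x + (f y + f 0)) = 0"
      using RK by (auto simp: radical_def add.assoc)
    then show "f (x + y) + f 0 = f x + f 0 + (f y + f 0)"
      by (simp add: bit_add_eq_0_iff ac_simps)
  qed
  then consider "(\<Sum>h\<in>?R. chi (f h + f 0)) = 0" | "(\<Sum>h\<in>?R. chi (f h + f 0)) = real (card ?R)"
    by presburger
  then show ?thesis
  proof cases
    case 1
    then show ?thesis
      by (simp add: avg_def power_divide sum_chi_quad_square[OF K f])
  next
    case 2
    obtain k where k: "card K = 2 ^ k * card ?R"
      using el2_group_transversal[OF K R RK] by blast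
    have "(avg K (\<lambda>x. chi (f x)))\<^sup>2 = 1 / 2 ^ k"
      using el2_groupD(5)[OF K] el2_groupD(5)[OF R] k
      by (simp add: avg_def power_divide sum_chi_quad_square[OF K f] 2) (simp add: power2_eq_square)
    then show ?thesis by blast
  qed
qed

text \<open>A radical element \<open>h\<close> shifts \<open>f\<close> by the constant
  \<open>f h + f 0\<close>; requiring that to be 0 leaves the translations preserving
  \<open>f\<close>. Their codimension serves as the rank: the number of linear forms on which
  \<open>f\<close> depends.\<close>

definition periods :: "'a::ab_group_add set \<Rightarrow> ('a \<Rightarrow> bit) \<Rightarrow> 'a set" where
  "periods K f = {h \<in> radical K f. f h = f 0}"

lemma periods_subset: "periods K f \<subseteq> K"
  by (auto simp: periods_def radical_def)

lemma periods_invariant: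
  assumes "h \<in> periods K f" "x \<in> K"
  shows "f (x + h) = f x"
proof -
  have "f (h + x) + f h + f x + f 0 = 0" "f h = f 0"
    using assms by (auto simp: periods_def radical_def)
  then have "f (h + x) + f x = 0" by (simp add: ac_simps)
  then show ?thesis by (simp add: bit_add_eq_0_iff add.commute)
qed

lemma radical_add:
  assumes "a \<in> radical K f" "h \<in> K"
  shows "f (a + h) = f a + f h + f 0"
proof -
  have "f (a + h) + (f a + f h + f 0) = 0"
    using assms by (auto simp: radical_def add.assoc)
  then show ?thesis by (simp only: bit_add_eq_0_iff)
qed

lemma el2_group_periods:
  assumes K: "el2_group K" and f: "quad_on K f"
  shows "el2_group (periods K f)"
proof -
  note R = el2_groupD[OF el2_group_radical[OF K f]]
  have "f (x + y) = f 0" if "x \<in> periods K f" "y \<in> periods K f" for x y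
    using that radical_add[of x K f y] by (auto simp: periods_def radical_def)
  then show ?thesis
    using R by (auto simp: el2_group_def periods_def)
qed

text \<open>\<open>f + f 0\<close> is additive on the radical with kernel
  \<open>periods K f\<close>, so the radical is at most two cosets of that kernel.\<close>

lemma card_radical_le:
  assumes K: "el2_group K" and f: "quad_on K f"
  shows "card (radical K f) \<le> 2 * card (periods K f)"
proof (cases "radical K f = periods K f")
  case False
  note R = el2_groupD[OF el2_group_radical[OF K f]]
  from False obtain a where a: "a \<in> radical K f" "f a \<noteq> f 0" by (auto simp: periods_def)
  let ?P = "periods K f"
  have fin: "finite ?P" using R(1) by (simp add: periods_def)
  have "h \<in> ?P \<union> (\<lambda>x. a + x) ` ?P" if h: "h \<in> radical K f" for h
  proof (cases "f h = f 0")
    case True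
    then show ?thesis using h by (simp add: periods_def)
  next
    case False
    have "f (a + h) = f a + f h + f 0"
      using radical_add[OF a(1)] h by (simp add: radical_def)
    also have "\<dots> = f 0" using False a(2) by (cases "f a"; cases "f h"; cases "f 0") auto
    finally have "a + h \<in> ?P" using R(3)[OF a(1) h] by (simp add: periods_def)
    moreover have "h = a + (a + h)"
      using el2_group_add_add[OF el2_group_radical[OF K f] a(1)] by simp
    ultimately show ?thesis by blast
  qed
  then have "card (radical K f) \<le> card (?P \<union> (\<lambda>x. a + x) ` ?P)"
    using fin by (intro card_mono) auto
  also have "\<dots> \<le> card ?P + card ((\<lambda>x. a + x) ` ?P)" by (rule card_Un_le)
  also have "\<dots> \<le> 2 * card ?P" using card_image_le[OF fin, of "\<lambda>x. a + x"] by simp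
  finally show ?thesis .
qed simp

subsection \<open>Overlap with the Bernoulli distribution\<close>

text \<open>An output vector is encoded as the set of its ones, so that passing to fewer outputs is
  intersecting with their index set.\<close>

definition outcome :: "('i \<Rightarrow> 'a \<Rightarrow> bit) \<Rightarrow> 'i set \<Rightarrow> 'a \<Rightarrow> 'i set" where
  "outcome f J x = {j \<in> J. f j x = 1}"

definition law :: "('i \<Rightarrow> 'a \<Rightarrow> bit) \<Rightarrow> 'i set \<Rightarrow> 'a set \<Rightarrow> 'i set \<Rightarrow> real" where
  "law f J K S = avg K (\<lambda>x. of_bool (outcome f J x = S))"

definition ber :: "'i set \<Rightarrow> 'i set \<Rightarrow> real" where
  "ber J S = (\<Prod>j\<in>J. if j \<in> S then 1/3 else 2/3)"

definition overlap :: "'i set \<Rightarrow> ('i set \<Rightarrow> real) \<Rightarrow> real" where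
  "overlap J p = (\<Sum>S\<in>Pow J. min (p S) (ber J S))"

lemma avg_mono: "(\<And>x. x \<in> K \<Longrightarrow> \<phi> x \<le> \<psi> x) \<Longrightarrow> avg K \<phi> \<le> avg K \<psi>"
  unfolding avg_def by (intro divide_right_mono sum_mono) auto

lemma avg_add: "avg K (\<lambda>x. \<phi> x + \<psi> x) = avg K \<phi> + avg K \<psi>"
  by (simp add: avg_def sum.distrib add_divide_distrib)

lemma avg_const: "finite K \<Longrightarrow> K \<noteq> {} \<Longrightarrow> avg K (\<lambda>_. c) = c"
  by (simp add: avg_def card_eq_0_iff)

lemma avg_cmult: "avg K (\<lambda>x. c * \<phi> x) = c * avg K \<phi>"
  by (simp add: avg_def sum_distrib_left[symmetric])

lemma avg_sum: "avg K (\<lambda>x. \<Sum>i\<in>I. \<phi> i x) = (\<Sum>i\<in>I. avg K (\<phi> i))"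
  unfolding avg_def by (subst sum.swap) (simp add: sum_divide_distrib)

lemma avg_nonneg: "(\<And>x. x \<in> K \<Longrightarrow> 0 \<le> \<phi> x) \<Longrightarrow> 0 \<le> avg K \<phi>"
  unfolding avg_def by (intro divide_nonneg_nonneg sum_nonneg) auto

lemma law_nonneg: "0 \<le> law f J K S"
  unfolding law_def by (rule avg_nonneg) simp

lemma ber_nonneg: "0 \<le> ber J S"
  unfolding ber_def by (rule prod_nonneg) auto

lemma sum_Pow_prod_if:
  fixes a b :: "'i \<Rightarrow> real"
  assumes "finite J"
  shows "(\<Sum>S\<in>Pow J. \<Prod>j\<in>J. if j \<in> S then a j else b j) = (\<Prod>j\<in>J. a j + b j)"
  unfolding prod_add[OF assms]
proof (rule sum.cong[OF refl])
  fix S assume "S \<in> Pow J"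
  then have "J \<inter> {j. j \<in> S} = S" "J \<inter> - {j. j \<in> S} = J - S" by auto
  then show "(\<Prod>j\<in>J. if j \<in> S then a j else b j) = prod a S * prod b (J - S)"
    using prod.If_cases[OF assms, of "\<lambda>j. j \<in> S" a b] by simp
qed

section \<open>Marginals and subadditivity of the overlap\<close>

lemma sum_ber_fiber:
  assumes "finite A" "J \<subseteq> A" "T \<subseteq> J"
  shows "(\<Sum>S\<in>{S \<in> Pow A. S \<inter> J = T}. ber A S) = ber J T"
proof -
  \<comment> \<open>On \<open>J\<close> the value that disagrees with \<open>T\<close> gets weight
    0, so the product vanishes unless \<open>S \<inter> J = T\<close>. The fibre sum becomes a full
    sum over \<open>Pow A\<close>, which factorizes.\<close>
  let ?a = "\<lambda>j. if j \<in> J then (if j \<in> T then 1/3 else 0) else 1/3 :: real"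
  let ?b = "\<lambda>j. if j \<in> J then (if j \<in> T then 0 else 2/3) else 2/3 :: real"
  have pt: "(\<Prod>j\<in>A. if j \<in> S then ?a j else ?b j) = (if S \<inter> J = T then ber A S else 0)" for S
  proof (cases "S \<inter> J = T")
    case True
    then show ?thesis using assms(3) unfolding ber_def by (auto intro!: prod.cong)
  next
    case False
    then obtain j where "j \<in> J" "j \<in> S \<longleftrightarrow> j \<notin> T" using assms(3) by blast
    then have "\<exists>j\<in>A. (if j \<in> S then ?a j else ?b j) = 0" using assms(2) by (intro bexI[of _ j]) auto
    then show ?thesis using False assms(1) by (simp add: prod_zero_iff)
  qed
  have "(\<Sum>S\<in>{S \<in> Pow A. S \<inter> J = T}. ber A S) = (\<Sum>S\<in>Pow A. if S \<inter> J = T then ber A S else 0)"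
    using assms(1) by (intro sum.inter_filter) simp
  also have "\<dots> = (\<Prod>j\<in>A. ?a j + ?b j)"
    using sum_Pow_prod_if[OF assms(1), of ?a ?b] by (simp only: pt)
  also have "\<dots> = (\<Prod>j\<in>A. if j \<in> J then (if j \<in> T then 1/3 else 2/3) else 1)"
    by (intro prod.cong) auto
  also have "\<dots> = (\<Prod>j\<in>A \<inter> J. if j \<in> T then 1/3 else 2/3)"
    using assms(1) by (simp add: prod.inter_restrict)
  also have "A \<inter> J = J" using assms(2) by blast
  finally show ?thesis by (simp add: ber_def)
qed

lemma sum_law_fiber:
  assumes "finite A" "J \<subseteq> A" "T \<subseteq> J"
  shows "(\<Sum>S\<in>{S \<in> Pow A. S \<inter> J = T}. law f A K S) = law f J K T"
  unfolding law_def avg_sum[symmetric]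
proof (rule arg_cong[where f = "avg K"], rule ext)
  fix x
  have "(\<Sum>S\<in>{S \<in> Pow A. S \<inter> J = T}. of_bool (outcome f A x = S) :: real) =
      of_bool (outcome f A x \<in> {S \<in> Pow A. S \<inter> J = T})"
    using assms(1) by (simp add: of_bool_def)
  also have "outcome f A x \<in> {S \<in> Pow A. S \<inter> J = T} \<longleftrightarrow> outcome f J x = T"
    using assms(2) by (auto simp: outcome_def)
  finally show "(\<Sum>S\<in>{S \<in> Pow A. S \<inter> J = T}. of_bool (outcome f A x = S) :: real) =
      of_bool (outcome f J x = T)" .
qed

text \<open>Dropping outputs adds up masses along fibres, and a sum of minima is at most the minimum
  of the sums.\<close>

lemma overlap_law_subset:
  assumes "finite A" "J \<subseteq> A"
  shows "overlap A (law f A K) \<le> overlap J (law f J K)"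
proof -
  have finJ: "finite J" using assms finite_subset by blast
  have "overlap A (law f A K) =
      (\<Sum>T\<in>Pow J. \<Sum>S\<in>{S \<in> Pow A. S \<inter> J = T}. min (law f A K S) (ber A S))"
    unfolding overlap_def using assms(1) finJ by (intro sum.group[symmetric]) auto
  also have "\<dots> \<le> (\<Sum>T\<in>Pow J. min (law f J K T) (ber J T))"
  proof (intro sum_mono min.boundedI)
    fix T assume T: "T \<in> Pow J"
    let ?F = "{S \<in> Pow A. S \<inter> J = T}"
    have "(\<Sum>S\<in>?F. min (law f A K S) (ber A S)) \<le> (\<Sum>S\<in>?F. law f A K S)"
      by (intro sum_mono) simp
    then show "(\<Sum>S\<in>?F. min (law f A K S) (ber A S)) \<le> law f J K T"
      using sum_law_fiber[OF assms, of T f K] T by simp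
    have "(\<Sum>S\<in>?F. min (law f A K S) (ber A S)) \<le> (\<Sum>S\<in>?F. ber A S)"
      by (intro sum_mono) simp
    then show "(\<Sum>S\<in>?F. min (law f A K S) (ber A S)) \<le> ber J T"
      using sum_ber_fiber[OF assms, of T] T by simp
  qed
  finally show ?thesis by (simp add: overlap_def)
qed

lemma overlap_mono: "(\<And>S. S \<in> Pow J \<Longrightarrow> p S \<le> q S) \<Longrightarrow> overlap J p \<le> overlap J q"
  unfolding overlap_def by (intro sum_mono min.mono) auto

lemma overlap_sum:
  assumes "finite I" "\<And>i S. i \<in> I \<Longrightarrow> 0 \<le> q i S"
  shows "overlap J (\<lambda>S. \<Sum>i\<in>I. q i S) \<le> (\<Sum>i\<in>I. overlap J (q i))"
proof -
  have "min (\<Sum>i\<in>I. q i S) (ber J S) \<le> (\<Sum>i\<in>I. min (q i S) (ber J S))" for S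
    using assms
  proof (induction I rule: finite_induct)
    case (insert i I)
    have "0 \<le> q i S" "0 \<le> (\<Sum>i\<in>I. q i S)" using insert.prems by (auto intro: sum_nonneg)
    then have "min (q i S + (\<Sum>i\<in>I. q i S)) (ber J S) \<le>
        min (q i S) (ber J S) + min (\<Sum>i\<in>I. q i S) (ber J S)"
      using ber_nonneg[of J S] by (auto simp: min_def)
    moreover have "min (\<Sum>i\<in>I. q i S) (ber J S) \<le> (\<Sum>i\<in>I. min (q i S) (ber J S))"
      using insert by auto
    ultimately show ?case using insert.hyps by simp
  qed (use ber_nonneg in auto)
  then show ?thesis
    unfolding overlap_def by (subst sum.swap) (intro sum_mono)
qed

text \<open>The overlap is concave in the law, so averaging the overlaps on the cosets gives no
  upper bound. Instead the law on \<open>G\<close> is dominated by the unweighted sum of the coset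
  laws, at the price of a factor \<open>2 ^ w\<close>.\<close>

lemma overlap_le_cosets:
  assumes G: "el2_group G" and K: "el2_group K" and sub: "K \<subseteq> G"
    and index: "card G \<le> 2 ^ w * card K" and \<epsilon>: "0 \<le> \<epsilon>"
    and le: "\<And>t. t \<in> G \<Longrightarrow> overlap J (law (\<lambda>j x. f j (t + x)) J K) \<le> \<epsilon>"
  shows "overlap J (law f J G) \<le> 2 ^ w * \<epsilon>"
proof -
  obtain k T where T: "T \<subseteq> G" "card T \<le> 2 ^ k" "card G = 2 ^ k * card K"
    "G = (\<Union>t\<in>T. (\<lambda>x. t + x) ` K)"
    using el2_group_transversal[OF G K sub] by blast
  have finT: "finite T" using T(1) el2_groupD(1)[OF G] finite_subset by blast
  have "(2::nat) ^ k \<le> 2 ^ w" using index T(3) el2_groupD(5)[OF K] by simp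
  then have cT: "card T \<le> 2 ^ w" using T(2) by linarith
  let ?p = "\<lambda>t. law (\<lambda>j x. f j (t + x)) J K"
  have "law f J G S \<le> (\<Sum>t\<in>T. ?p t S)" for S
  proof -
    let ?\<phi> = "\<lambda>x. of_bool (outcome f J x = S) :: real"
    have img: "G = (\<lambda>(t, x). t + x) ` (T \<times> K)" using T(4) by auto
    have "(\<Sum>x\<in>G. ?\<phi> x) \<le> (\<Sum>(t, x)\<in>T \<times> K. ?\<phi> (t + x))"
      unfolding img
      using sum_image_le[of "T \<times> K" ?\<phi> "\<lambda>(t, x). t + x"] finT el2_groupD(1)[OF K]
      by (simp add: comp_def case_prod_unfold)
    also have "\<dots> = (\<Sum>t\<in>T. \<Sum>x\<in>K. ?\<phi> (t + x))"
      by (rule sum.cartesian_product[symmetric])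
    finally have "law f J G S \<le> (\<Sum>t\<in>T. \<Sum>x\<in>K. ?\<phi> (t + x)) / card G"
      unfolding law_def avg_def by (rule divide_right_mono) simp
    also have "\<dots> \<le> (\<Sum>t\<in>T. \<Sum>x\<in>K. ?\<phi> (t + x)) / card K"
      using el2_groupD(5)[OF K] card_mono[OF el2_groupD(1)[OF G] sub]
      by (intro divide_left_mono sum_nonneg) auto
    also have "\<dots> = (\<Sum>t\<in>T. ?p t S)"
      by (simp add: law_def avg_def outcome_def sum_divide_distrib)
    finally show ?thesis .
  qed
  then have "overlap J (law f J G) \<le> overlap J (\<lambda>S. \<Sum>t\<in>T. ?p t S)"
    by (intro overlap_mono)
  also have "\<dots> \<le> (\<Sum>t\<in>T. overlap J (?p t))"
    by (intro overlap_sum finT law_nonneg)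
  also have "\<dots> \<le> (\<Sum>t\<in>T. \<epsilon>)"
    using T(1) by (intro sum_mono le) auto
  also have "\<dots> = real (card T) * \<epsilon>" by simp
  also have "\<dots> \<le> 2 ^ w * \<epsilon>"
    using cT \<epsilon> by (intro mult_right_mono) (metis of_nat_le_iff of_nat_numeral of_nat_power, simp)
  finally show ?thesis .
qed

text \<open>Whatever the common summand \<open>P\<close> is, conditionally on its value it acts as a constant.\<close>

lemma overlap_law_common_summand:
  "overlap J (law (\<lambda>j x. P x + L j x) J K) \<le>
    overlap J (law L J K) + overlap J (law (\<lambda>j x. L j x + 1) J K)"
proof -
  let ?q = "\<lambda>b::bool. law (\<lambda>j x. L j x + of_bool b) J K"
  have "law (\<lambda>j x. P x + L j x) J K S \<le> (\<Sum>b\<in>UNIV. ?q b S)" for S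
  proof -
    have "of_bool (outcome (\<lambda>j x. P x + L j x) J x = S) \<le>
        of_bool (outcome L J x = S) + (of_bool (outcome (\<lambda>j x. L j x + 1) J x = S) :: real)" for x
      by (cases "P x") (auto simp: outcome_def add.commute)
    then show ?thesis
      by (simp add: law_def avg_add[symmetric] UNIV_bool add.commute avg_mono)
  qed
  then have "overlap J (law (\<lambda>j x. P x + L j x) J K) \<le> overlap J (\<lambda>S. \<Sum>b\<in>UNIV. ?q b S)"
    by (intro overlap_mono)
  also have "\<dots> \<le> (\<Sum>b\<in>UNIV. overlap J (?q b))"
    by (intro overlap_sum law_nonneg) simp
  finally show ?thesis by (simp add: UNIV_bool add.commute)
qed

text \<open>\<open>1 / 40000 = 2 * (1/100)\<^sup>2 / 8\<close>: each of the two outcomes of a bit of probability \<open>q\<close> loses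
  \<open>(sqrt u - sqrt v)\<^sup>2 / 2 \<ge> (u - v)\<^sup>2 / 8\<close> in the affinity, and \<open>u - v\<close> is at least \<open>1/100\<close>.\<close>

definition \<rho> :: real where "\<rho> = 1 - 1 / 40000"

text \<open>The left side is the Bhattacharyya affinity of two bits: 1 minus half the sum of the
  squared differences of the square roots. Those are bounded below by \<open>sep\<close>, as
  \<open>u - v\<close> is \<open>sqrt u - sqrt v\<close> times a factor of at most 2.\<close>

lemma affinity_le:
  assumes "0 \<le> q" "q \<le> 1" "\<bar>q - 1/3\<bar> \<ge> 1/100"
  shows "sqrt q * sqrt (1/3) + sqrt (1 - q) * sqrt (2/3) \<le> \<rho>"
proof -
  have sep: "(u - v)\<^sup>2 / 4 \<le> (sqrt u - sqrt v)\<^sup>2" if "0 \<le> u" "u \<le> 1" "0 \<le> v" "v \<le> 1" for u v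
  proof -
    have s: "0 \<le> sqrt u" "sqrt u \<le> 1" "0 \<le> sqrt v" "sqrt v \<le> 1" using that by auto
    have "u - v = (sqrt u)\<^sup>2 - (sqrt v)\<^sup>2" using that by simp
    also have "\<dots> = (sqrt u - sqrt v) * (sqrt u + sqrt v)"
      by (simp add: power2_eq_square algebra_simps)
    finally have eq: "u - v = (sqrt u - sqrt v) * (sqrt u + sqrt v)" .
    have "(sqrt u + sqrt v)\<^sup>2 \<le> (1 + 1)\<^sup>2"
      by (rule power_mono[OF add_mono[OF s(2,4)] add_nonneg_nonneg[OF s(1,3)]])
    then have "(sqrt u + sqrt v)\<^sup>2 \<le> 4" by simp
    then have "(sqrt u - sqrt v)\<^sup>2 * (sqrt u + sqrt v)\<^sup>2 \<le> (sqrt u - sqrt v)\<^sup>2 * 4"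
      by (intro mult_left_mono) auto
    then show ?thesis by (simp add: eq power_mult_distrib)
  qed
  have "(1/100)\<^sup>2 \<le> (q - 1/3)\<^sup>2"
    using power_mono[of "1/100" "\<bar>q - 1/3\<bar>" 2] assms(3) by simp
  moreover have "((1 - q) - 2/3)\<^sup>2 = (q - 1/3)\<^sup>2" by (simp add: power2_eq_square algebra_simps)
  ultimately have "1/20000 \<le> (sqrt q - sqrt (1/3))\<^sup>2 + (sqrt (1 - q) - sqrt (2/3))\<^sup>2"
    using sep[of q "1/3"] sep[of "1 - q" "2/3"] assms(1,2) by (simp add: power2_eq_square)
  moreover have "(sqrt q - sqrt (1/3))\<^sup>2 = q + 1/3 - 2 * (sqrt q * sqrt (1/3))"
    "(sqrt (1 - q) - sqrt (2/3))\<^sup>2 = 1 - q + 2/3 - 2 * (sqrt (1 - q) * sqrt (2/3))"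
    using assms(1,2) by (simp_all add: power2_diff)
  ultimately show ?thesis by (simp add: \<rho>_def)
qed

text \<open>A minimum is at most the geometric mean, and the affinity of two product laws factors
  over the bits. Assuming only domination by \<open>c\<close> times a product law covers both
  independent bits (\<open>c = 1\<close>) and nearly uniform ones (\<open>c = 2\<close>).\<close>

lemma overlap_product_le:
  assumes J: "finite J" and c: "1 \<le> c"
    and q: "\<And>j. j \<in> J \<Longrightarrow> 0 \<le> q j \<and> q j \<le> 1 \<and> \<bar>q j - 1/3\<bar> \<ge> 1/100"
    and p: "\<And>S. S \<in> Pow J \<Longrightarrow> p S \<le> c * (\<Prod>j\<in>J. if j \<in> S then q j else 1 - q j)"
  shows "overlap J p \<le> c * \<rho> ^ card J"
proof -
  let ?Q = "\<lambda>S. \<Prod>j\<in>J. if j \<in> S then q j else 1 - q j"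
  have "overlap J p \<le> (\<Sum>S\<in>Pow J. c * (\<Prod>j\<in>J. if j \<in> S then sqrt (q j) * sqrt (1/3)
      else sqrt (1 - q j) * sqrt (2/3)))"
    unfolding overlap_def
  proof (rule sum_mono)
    fix S assume S: "S \<in> Pow J"
    have Q: "0 \<le> ?Q S" using q by (intro prod_nonneg) auto
    note B = ber_nonneg[of J S]
    have "min (p S) (ber J S) \<le> min (c * ?Q S) (c * ber J S)"
      using p[OF S] B c mult_right_mono[of 1 c "ber J S"] by auto
    also have "\<dots> = c * min (?Q S) (ber J S)" using c by (simp add: min_mult_distrib_left)
    also have "min (?Q S) (ber J S) \<le> sqrt (?Q S) * sqrt (ber J S)"
    proof -
      have "sqrt (min (?Q S) (ber J S)) * sqrt (min (?Q S) (ber J S)) \<le> sqrt (?Q S) * sqrt (ber J S)"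
        using Q B by (intro mult_mono) auto
      then show ?thesis using Q B by (simp add: min_def split: if_splits)
    qed
    also have "sqrt (?Q S) * sqrt (ber J S) = (\<Prod>j\<in>J. if j \<in> S then sqrt (q j) * sqrt (1/3)
      else sqrt (1 - q j) * sqrt (2/3))"
    proof -
      have sp: "sqrt (prod u J) = (\<Prod>j\<in>J. sqrt (u j))" for u
        using J by (induction J rule: finite_induct) (auto simp: real_sqrt_mult)
      show ?thesis
        unfolding ber_def sp prod.distrib[symmetric] by (intro prod.cong refl) auto
    qed
    finally show "min (p S) (ber J S) \<le> c * (\<Prod>j\<in>J. if j \<in> S then sqrt (q j) * sqrt (1/3)
      else sqrt (1 - q j) * sqrt (2/3))" using c by simp
  qed
  also have "\<dots> = c * (\<Prod>j\<in>J. sqrt (q j) * sqrt (1/3) + sqrt (1 - q j) * sqrt (2/3))"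
    by (simp only: sum_distrib_left[symmetric] sum_Pow_prod_if[OF J])
  also have "\<dots> \<le> c * (\<Prod>j\<in>J. \<rho>)"
    using c q by (intro mult_left_mono prod_mono conjI affinity_le) auto
  finally show ?thesis by simp
qed

section \<open>Indicators of outcomes as products, and nearly uniform outputs\<close>

lemma of_bool_outcome:
  assumes "finite J" "S \<subseteq> J"
  shows "of_bool (outcome f J x = S) = (\<Prod>j\<in>J. of_bool (f j x = of_bool (j \<in> S)) :: real)"
proof (cases "outcome f J x = S")
  case True
  then have "\<forall>j\<in>J. f j x = of_bool (j \<in> S)" by (auto simp: outcome_def)
  then show ?thesis using True by simp
next
  case False
  moreover have "outcome f J x = S" if "\<forall>j\<in>J. f j x = of_bool (j \<in> S)"
    using that assms(2) by (auto simp: outcome_def)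
  ultimately obtain j where "j \<in> J" "f j x \<noteq> of_bool (j \<in> S)" by blast
  then have "(\<Prod>j\<in>J. of_bool (f j x = of_bool (j \<in> S)) :: real) = 0"
    using assms(1) by (intro prod_zero bexI[of _ j]) auto
  then show ?thesis using False by simp
qed

text \<open>Fourier expansion: the probability of \<open>S\<close> is \<open>(1/2) ^ card J\<close>
  times a signed sum of the biases of the subset sums. The empty subset contributes 1 and the others
  together at most 1, so the law is at most twice the uniform one.\<close>

lemma overlap_law_le_of_small_bias:
  fixes f :: "'i \<Rightarrow> 'a::ab_group_add \<Rightarrow> bit"
  assumes J: "finite J" and K: "finite K" "K \<noteq> {}"
    and bias: "\<And>T. T \<subseteq> J \<Longrightarrow> T \<noteq> {} \<Longrightarrow> \<bar>avg K (\<lambda>x. chi (\<Sum>j\<in>T. f j x))\<bar> \<le> (1/2) ^ card J"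
  shows "overlap J (law f J K) \<le> 2 * \<rho> ^ card J"
proof (rule overlap_product_le[OF J, where q = "\<lambda>_. 1/2"])
  fix S assume "S \<in> Pow J"
  then have S: "S \<subseteq> J" by simp
  define s where "s j = chi (of_bool (j \<in> S))" for j
  have ind: "of_bool (b = of_bool (j \<in> S)) = (1/2) * (1 + s j * chi b)" for b j
    by (cases b) (auto simp: s_def)
  have "law f J K S = avg K (\<lambda>x. (1/2) ^ card J * (\<Prod>j\<in>J. s j * chi (f j x) + 1))"
    unfolding law_def of_bool_outcome[OF J S] ind prod.distrib by (simp add: add.commute)
  also have "\<dots> = (1/2) ^ card J * avg K (\<lambda>x. \<Sum>T\<in>Pow J. prod s T * chi (\<Sum>j\<in>T. f j x))"
    unfolding avg_cmult prod_add[OF J]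
    using J finite_subset[of _ J] by (simp add: prod.distrib chi_sum)
  also have "avg K (\<lambda>x. \<Sum>T\<in>Pow J. prod s T * chi (\<Sum>j\<in>T. f j x)) =
      (\<Sum>T\<in>Pow J. prod s T * avg K (\<lambda>x. chi (\<Sum>j\<in>T. f j x)))"
    by (simp only: avg_sum avg_cmult)
  also have "\<dots> \<le> (\<Sum>T\<in>Pow J. (1/2) ^ card J + (if T = {} then 1 else 0))"
  proof (rule sum_mono)
    fix T assume T: "T \<in> Pow J"
    have "\<bar>prod s T\<bar> = (\<Prod>j\<in>T. \<bar>s j\<bar>)" by (rule abs_prod)
    also have "\<dots> = 1" by (intro prod.neutral) (auto simp: s_def)
    finally have s1: "\<bar>prod s T\<bar> = 1" .
    show "prod s T * avg K (\<lambda>x. chi (\<Sum>j\<in>T. f j x)) \<le> (1/2) ^ card J + (if T = {} then 1 else 0)"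
    proof (cases "T = {}")
      case False
      have "prod s T * avg K (\<lambda>x. chi (\<Sum>j\<in>T. f j x)) \<le>
          \<bar>prod s T\<bar> * \<bar>avg K (\<lambda>x. chi (\<Sum>j\<in>T. f j x))\<bar>"
        by (simp add: abs_mult[symmetric])
      then show ?thesis using bias[of T] T False s1 by simp
    qed (simp add: avg_const[OF K])
  qed
  also have "\<dots> = 2"
    using J by (simp add: sum.distrib card_Pow power_one_over)
  finally have "law f J K S \<le> (1/2) ^ card J * 2" by simp
  moreover have "(if j \<in> S then 1/2 else 1 - 1/2) = (1/2::real)" for j by simp
  ultimately show "law f J K S \<le> 2 * (\<Prod>j\<in>J. if j \<in> S then 1/2 else 1 - 1/2)"
    by (simp only: prod_constant mult.commute)
qed auto

subsection \<open>Outputs of low rank\<close>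

text \<open>Quantifying over all \<open>H j\<close>-periodic functions makes this a property of
  subgroups alone. It then applies on every coset \<open>t + K\<close>, since translating the
  argument keeps the periods.\<close>

definition indep_periods :: "'a::ab_group_add set \<Rightarrow> 'a set \<Rightarrow> ('i \<Rightarrow> 'a set) \<Rightarrow> 'i set \<Rightarrow> bool" where
  "indep_periods G K H J \<longleftrightarrow> (\<forall>\<phi> :: 'i \<Rightarrow> 'a \<Rightarrow> real.
     (\<forall>j\<in>J. \<forall>h\<in>H j. \<forall>x\<in>G. \<phi> j (x + h) = \<phi> j x) \<longrightarrow>
     avg K (\<lambda>x. \<Prod>j\<in>J. \<phi> j x) = (\<Prod>j\<in>J. avg K (\<phi> j)))"

text \<open>The nearest admissible values \<open>b = sqrt (1/8)\<close> and \<open>b = 1/4\<close> are both away from \<open>1/3\<close>,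
  the bias of a Bernoulli(1/3) bit.\<close>

lemma dyadic_square_away_from_third:
  fixes b :: real
  assumes "b\<^sup>2 = 0 \<or> (\<exists>k. b\<^sup>2 = 1 / 2 ^ k)"
  shows "\<bar>b - 1/3\<bar> \<ge> 1/50"
proof (rule ccontr)
  assume "\<not> \<bar>b - 1/3\<bar> \<ge> 1/50"
  then have b: "94/300 < b" "b < 106/300" by (auto simp: abs_if field_simps split: if_splits)
  have lo: "1/16 < b\<^sup>2" using power_strict_mono[of "94/300" b 2] b by (simp add: power2_eq_square)
  have hi: "b\<^sup>2 < 1/8" using power_strict_mono[of b "106/300" 2] b by (simp add: power2_eq_square)
  from assms lo obtain k where k: "b\<^sup>2 = 1 / 2 ^ k" by auto
  consider "k \<le> 3" | "4 \<le> k" by linarith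
  then show False
  proof cases
    case 1
    then have "(2::real) ^ k \<le> 2 ^ 3" by (intro power_increasing) auto
    then have "1/8 \<le> 1 / (2::real) ^ k" by (simp add: field_simps)
    then show False using hi k by simp
  next
    case 2
    then have "(2::real) ^ 4 \<le> 2 ^ k" by (intro power_increasing) auto
    then have "1 / (2::real) ^ k \<le> 1/16" by (simp add: field_simps)
    then show False using lo k by simp
  qed
qed

text \<open>The outputs stay quadratic on each coset, so their biases \<open>b\<close> avoid 1/3 by
  1/50, and the probabilities \<open>(1 - b) / 2\<close> of a one avoid 1/3 by 1/100.\<close>

lemma overlap_law_le_of_indep:
  assumes G: "el2_group G" and K: "el2_group K" and sub: "K \<subseteq> G" and J: "finite J"
    and ind: "indep_periods G K H J"
    and inv: "\<And>j h x. j \<in> J \<Longrightarrow> h \<in> H j \<Longrightarrow> x \<in> G \<Longrightarrow> f j (x + h) = f j x"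
    and quad: "\<And>j. j \<in> J \<Longrightarrow> quad_on G (f j)"
    and t: "t \<in> G"
  shows "overlap J (law (\<lambda>j x. f j (t + x)) J K) \<le> \<rho> ^ card J"
proof -
  define b where "b j = avg K (\<lambda>x. chi (f j (t + x)))" for j
  have K': "finite K" "K \<noteq> {}" using el2_groupD(1,2)[OF K] by auto
  have freq: "avg K (\<lambda>x. of_bool (f j (t + x) = of_bool B)) =
      (if B then (1 - b j) / 2 else 1 - (1 - b j) / 2)" for j B
  proof -
    have "of_bool (v = of_bool B) = (1/2) * (1 + (if B then - 1 else 1) * chi v)" for v
      by (cases v) auto
    then have "avg K (\<lambda>x. of_bool (f j (t + x) = of_bool B)) =
        (1/2) * (1 + (if B then - 1 else 1) * b j)"
      by (simp only: avg_cmult avg_add avg_const[OF K'] b_def)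
    then show ?thesis by (cases B) (simp_all add: field_simps)
  qed
  have b1: "\<bar>b j\<bar> \<le> 1" for j
  proof -
    have "avg K (\<lambda>_. - 1) \<le> b j" "b j \<le> avg K (\<lambda>_. 1)"
      unfolding b_def by (intro avg_mono; simp add: chi_def)+
    then show ?thesis by (simp add: avg_const[OF K'] abs_le_iff)
  qed
  have away: "\<bar>b j - 1/3\<bar> \<ge> 1/50" if "j \<in> J" for j
    unfolding b_def
    using quad_on_subset[OF quad_on_translate[OF G quad[OF that] t] sub]
    by (intro dyadic_square_away_from_third avg_chi_quad_square[OF K])
  have "overlap J (law (\<lambda>j x. f j (t + x)) J K) \<le> 1 * \<rho> ^ card J"
  proof (rule overlap_product_le[OF J, where q = "\<lambda>j. (1 - b j) / 2"])
    fix j assume "j \<in> J"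
    then have "\<bar>b j - 1/3\<bar> \<ge> 1/50" "\<bar>b j\<bar> \<le> 1" using away b1 by auto
    then show "0 \<le> (1 - b j) / 2 \<and> (1 - b j) / 2 \<le> 1 \<and> 1/100 \<le> \<bar>(1 - b j) / 2 - 1/3\<bar>"
      by (auto simp: abs_if field_simps split: if_splits)
  next
    fix S assume "S \<in> Pow J"
    then have S: "S \<subseteq> J" by simp
    let ?\<phi> = "\<lambda>j x. of_bool (f j (t + x) = of_bool (j \<in> S)) :: real"
    have "\<forall>j\<in>J. \<forall>h\<in>H j. \<forall>x\<in>G. ?\<phi> j (x + h) = ?\<phi> j x"
    proof (intro ballI)
      fix j h x assume "j \<in> J" "h \<in> H j" "x \<in> G"
      moreover from this have "t + x \<in> G" using t el2_groupD(3)[OF G] by blast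
      ultimately show "?\<phi> j (x + h) = ?\<phi> j x"
        using inv[of j h "t + x"] by (simp add: add.assoc)
    qed
    then have "avg K (\<lambda>x. \<Prod>j\<in>J. ?\<phi> j x) = (\<Prod>j\<in>J. avg K (?\<phi> j))"
      using ind unfolding indep_periods_def by (elim allE[of _ ?\<phi>]) blast
    then show "law (\<lambda>j x. f j (t + x)) J K S \<le>
        1 * (\<Prod>j\<in>J. if j \<in> S then (1 - b j) / 2 else 1 - (1 - b j) / 2)"
      unfolding law_def of_bool_outcome[OF J S] by (simp add: freq)
  qed simp
  then show ?thesis by simp
qed

lemma el2_group_Int_INT:
  assumes "el2_group K" "finite J" "\<And>j. j \<in> J \<Longrightarrow> el2_group (H j)"
  shows "el2_group (K \<inter> (\<Inter>j\<in>J. H j))"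
  using assms(2,3)
proof (induction J rule: finite_induct)
  case (insert j J)
  have "K \<inter> (\<Inter>j\<in>insert j J. H j) = (K \<inter> (\<Inter>j\<in>J. H j)) \<inter> H j" by auto
  then show ?case using insert by (auto intro: el2_group_Int)
qed (simp add: assms)

text \<open>The product over \<open>J\<close> is invariant under the common periods of
  \<open>J\<close>, and \<open>\<phi> j\<close> under \<open>H j\<close>; as these generate
  \<open>K\<close>, \<open>avg_mult_transversal\<close> applies.\<close>

lemma indep_periods_insert:
  assumes K: "el2_group K" and sub: "K \<subseteq> G" and J: "finite J" "j \<notin> J"
    and H: "\<And>i. i \<in> insert j J \<Longrightarrow> el2_group (H i)"
    and ind: "indep_periods G K H J"
    and sum: "K = {a + b |a b. a \<in> K \<inter> (\<Inter>i\<in>J. H i) \<and> b \<in> K \<inter> H j}"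
  shows "indep_periods G K H (insert j J)"
  unfolding indep_periods_def
proof (intro allI impI)
  fix \<phi> :: "'b \<Rightarrow> 'a \<Rightarrow> real"
  assume inv: "\<forall>i\<in>insert j J. \<forall>h\<in>H i. \<forall>x\<in>G. \<phi> i (x + h) = \<phi> i x"
  have "avg K (\<lambda>x. \<Prod>i\<in>insert j J. \<phi> i x) = avg K (\<lambda>x. (\<Prod>i\<in>J. \<phi> i x) * \<phi> j x)"
    using J by (simp add: mult.commute)
  also have "\<dots> = avg K (\<lambda>x. \<Prod>i\<in>J. \<phi> i x) * avg K (\<phi> j)"
  proof (rule avg_mult_transversal[OF _ _ K sum])
    show "el2_group (K \<inter> (\<Inter>i\<in>J. H i))" using H by (intro el2_group_Int_INT K J) auto
    show "el2_group (K \<inter> H j)" using H by (intro el2_group_Int K) auto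
    show "(\<Prod>i\<in>J. \<phi> i (x + a)) = (\<Prod>i\<in>J. \<phi> i x)" if "x \<in> K" "a \<in> K \<inter> (\<Inter>i\<in>J. H i)" for x a
      using that inv sub by (intro prod.cong refl) auto
    show "\<phi> j (x + b) = \<phi> j x" if "x \<in> K" "b \<in> K \<inter> H j" for x b
      using that inv sub by auto
  qed
  also have "avg K (\<lambda>x. \<Prod>i\<in>J. \<phi> i x) = (\<Prod>i\<in>J. avg K (\<phi> i))"
    using ind inv unfolding indep_periods_def by blast
  finally show "avg K (\<lambda>x. \<Prod>i\<in>insert j J. \<phi> i x) = (\<Prod>i\<in>insert j J. avg K (\<phi> i))"
    using J by (simp add: mult.commute)
qed

text \<open>A linear sunflower argument. Either many outputs are independent on every coset of \<open>K\<close>, or a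
  maximal independent family \<open>J\<close> is small, and passing to the common periods of \<open>J\<close> inside \<open>K\<close>
  costs little while the index of the periods of every output drops. Since the whole group \<open>K\<close> is
  shrunk, no output is lost in such a step.\<close>

lemma overlap_law_le_of_low_index:
  fixes f :: "'i \<Rightarrow> 'a::ab_group_add \<Rightarrow> bit"
  assumes G: "el2_group G" and A: "finite A"
    and H: "\<And>j. j \<in> A \<Longrightarrow> el2_group (H j)"
    and inv: "\<And>j h x. j \<in> A \<Longrightarrow> h \<in> H j \<Longrightarrow> x \<in> G \<Longrightarrow> f j (x + h) = f j x"
    and quad: "\<And>j. j \<in> A \<Longrightarrow> quad_on G (f j)"
    and C: "2 \<le> C" "\<rho> ^ C \<le> 1/2"
    and "el2_group K" "K \<subseteq> G" "card G \<le> 2 ^ w * card K"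
    and "\<And>j. j \<in> A \<Longrightarrow> card K \<le> 2 ^ d * card (K \<inter> H j)"
    and "d \<le> r" "C * (w + e) * (1 + C * r) ^ d \<le> card A"
  shows "overlap A (law f A G) \<le> (1/2) ^ e"
  using assms(8-13)
\<comment> \<open>\<open>w\<close> bounds the codimension of \<open>K\<close> in \<open>G\<close>,
  and \<open>d\<close> that of the periods of each output in \<open>K\<close>. A step lowers
  \<open>d\<close> by 1 and multiplies \<open>w + e\<close> by at most \<open>1 + C * r\<close>,
  which the size condition on \<open>A\<close> pays for; \<open>r\<close> bounds every
  \<open>d\<close> that occurs.\<close>
proof (induction d arbitrary: K w)
  case 0
  note K = \<open>el2_group K\<close> and sub = \<open>K \<subseteq> G\<close>
  have KH: "K \<subseteq> H j" if "j \<in> A" for j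
  proof -
    have "card K \<le> card (K \<inter> H j)" using 0(4)[OF that] by simp
    then have "K \<inter> H j = K" using el2_groupD(1)[OF K] by (intro card_seteq) auto
    then show ?thesis by blast
  qed
  \<comment> \<open>All outputs are constant on each coset, so its law is a point mass and the
    overlap a single Bernoulli weight. As (2/3)^2 < 1/2, \<open>2 * (w + e)\<close> outputs outweigh
    the \<open>2 ^ w\<close> cosets.\<close>
  have "overlap A (law (\<lambda>j x. f j (t + x)) A K) \<le> (2/3) ^ card A" if t: "t \<in> G" for t
  proof -
    let ?S = "outcome f A t"
    have "f j (t + x) = f j t" if "j \<in> A" "x \<in> K" for j x
      using inv[OF that(1) _ t] KH[OF that(1)] that(2) by blast
    then have const: "outcome (\<lambda>j x. f j (t + x)) A x = ?S" if "x \<in> K" for x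
      using that by (auto simp: outcome_def)
    have "law (\<lambda>j x. f j (t + x)) A K S = of_bool (?S = S)" for S
    proof -
      have "law (\<lambda>j x. f j (t + x)) A K S = avg K (\<lambda>_. of_bool (?S = S))"
        unfolding law_def avg_def by (simp add: const)
      also have "\<dots> = of_bool (?S = S)"
        using el2_groupD(1,2)[OF K] by (intro avg_const) auto
      finally show ?thesis .
    qed
    then have "overlap A (law (\<lambda>j x. f j (t + x)) A K) \<le> (\<Sum>S\<in>Pow A. if S = ?S then ber A S else 0)"
      unfolding overlap_def by (intro sum_mono) (auto simp: ber_nonneg)
    also have "\<dots> = ber A ?S"
      using A by (simp add: outcome_def)
    also have "\<dots> \<le> (\<Prod>j\<in>A. 2/3)" unfolding ber_def by (intro prod_mono) auto
    finally show ?thesis by simp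
  qed
  then have "overlap A (law f A G) \<le> 2 ^ w * (2/3) ^ card A"
    by (intro overlap_le_cosets[OF G K sub 0(3)]) auto
  also have "\<dots> \<le> 2 ^ w * (2/3) ^ (2 * (w + e))"
  proof -
    have "2 * (w + e) \<le> C * (w + e)" using C(1) by (rule mult_le_mono1)
    then have "2 * (w + e) \<le> card A" using 0(6) by simp
    then show ?thesis by (intro mult_left_mono power_decreasing) auto
  qed
  also have "\<dots> = 2 ^ w * (4/9) ^ (w + e)"
    unfolding power_mult by (simp add: power2_eq_square)
  also have "\<dots> \<le> 2 ^ w * (1/2) ^ (w + e)" by (intro mult_left_mono power_mono) auto
  also have "\<dots> = (1/2) ^ e" by (simp add: power_add power_one_over)
  finally show ?case .
next
  case (Suc d)
  note K = \<open>el2_group K\<close> and sub = \<open>K \<subseteq> G\<close>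
  \<comment> \<open>\<open>s\<close> independent outputs suffice:
    \<open>2 ^ w * \<rho> ^ s \<le> (1/2) ^ e\<close> by the choice of \<open>C\<close>. In
    \<open>good\<close>, each member of \<open>J\<close> may cost \<open>Suc d\<close> dimensions;
    the cap \<open>s\<close> makes a largest good set exist and bounds the total cost.\<close>
  define s where "s = C * (w + e)"
  define KJ where "KJ J = K \<inter> (\<Inter>j\<in>J. H j)" for J
  define good where "good J \<longleftrightarrow> J \<subseteq> A \<and> indep_periods G K H J \<and>
    card K \<le> 2 ^ (Suc d * card J) * card (KJ J) \<and> card J \<le> s" for J
  have "finite K" "K \<noteq> {}" using el2_groupD(1,2)[OF K] by auto
  then have "good {}"
    by (simp add: good_def indep_periods_def KJ_def avg_const)
  moreover have "\<forall>J. good J \<longrightarrow> card J < Suc s" by (auto simp: good_def)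
  ultimately obtain J where J: "good J" and max: "\<And>J'. good J' \<Longrightarrow> card J' \<le> card J"
    using ex_has_greatest_nat[of good "{}" card "Suc s"] by auto
  have JA: "J \<subseteq> A" and ind: "indep_periods G K H J" and cJ: "card J \<le> s"
    and KKJ: "card K \<le> 2 ^ (Suc d * card J) * card (KJ J)"
    using J by (auto simp: good_def)
  have finJ: "finite J" using JA A finite_subset by blast
  show ?case
  proof (cases "card J = s")
    case True
    have "overlap A (law f A G) \<le> overlap J (law f J G)"
      by (rule overlap_law_subset[OF A JA])
    also have "\<dots> \<le> 2 ^ w * \<rho> ^ card J"
    proof (rule overlap_le_cosets[OF G K sub Suc.prems(3)])
      show "overlap J (law (\<lambda>j x. f j (t + x)) J K) \<le> \<rho> ^ card J" if "t \<in> G" for t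
        using JA inv quad that by (intro overlap_law_le_of_indep[OF G K sub finJ ind]) auto
    qed (simp add: \<rho>_def)
    also have "\<dots> = 2 ^ w * (\<rho> ^ C) ^ (w + e)" by (simp add: True s_def power_mult)
    also have "\<dots> \<le> 2 ^ w * (1/2) ^ (w + e)"
      using C(2) by (intro mult_left_mono power_mono) (auto simp: \<rho>_def)
    also have "\<dots> = (1/2) ^ e" by (simp add: power_add power_one_over)
    finally show ?thesis .
  next
    case False
    then have Js: "card J < s" using cJ by simp
    have KJ: "el2_group (KJ J)" unfolding KJ_def using H JA by (intro el2_group_Int_INT K finJ) auto
    have KJK: "KJ J \<subseteq> K" by (auto simp: KJ_def)
    \<comment> \<open>For \<open>j\<close> outside \<open>J\<close>, let \<open>M\<close> be the sum
      of \<open>KJ J\<close> and \<open>B = K \<inter> H j\<close>. If \<open>M = K\<close>, then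
      \<open>insert j J\<close> would be good, against maximality. So \<open>M\<close> has index at
      least 2 in \<open>K\<close>, and the index of \<open>KJ J \<inter> H j\<close> in
      \<open>KJ J\<close>, equal to that of \<open>B\<close> in \<open>M\<close>, is at most half of
      \<open>2 ^ Suc d\<close>.\<close>
    have drop: "card (KJ J) \<le> 2 ^ d * card (KJ J \<inter> H j)" if j: "j \<in> A" for j
    proof (cases "j \<in> J")
      case True
      then have "KJ J \<inter> H j = KJ J" by (auto simp: KJ_def)
      then show ?thesis by simp
    next
      case False
      define B where "B = K \<inter> H j"
      have B: "el2_group B" unfolding B_def by (intro el2_group_Int K H j)
      have BK: "B \<subseteq> K" by (simp add: B_def)
      define M where "M = {a + b |a b. a \<in> KJ J \<and> b \<in> B}"
      have M: "el2_group M" unfolding M_def by (rule el2_group_set_plus[OF K KJ B KJK BK])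
      have MK: "M \<subseteq> K" unfolding M_def using el2_groupD(3)[OF K] KJK BK by blast
      have "KJ J \<inter> B = KJ J \<inter> H j" using KJK by (auto simp: B_def)
      then have prod: "card M * card (KJ J \<inter> H j) = card (KJ J) * card B"
        using el2_group_card_set_plus[OF KJ B] by (simp add: M_def)
      have KB: "card K \<le> 2 ^ Suc d * card B" unfolding B_def by (rule Suc.prems(4)[OF j])
      have cB: "0 < card B" by (rule el2_groupD(5)[OF B])
      have "M \<noteq> K"
      proof
        assume MK: "M = K"
        have "KJ (insert j J) = KJ J \<inter> H j" by (auto simp: KJ_def)
        then have "card (KJ J) * card B \<le> 2 ^ Suc d * card (KJ (insert j J)) * card B"
          using prod MK mult_le_mono1[OF KB, of "card (KJ J \<inter> H j)"] by (simp add: ac_simps)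
        then have "card (KJ J) \<le> 2 ^ Suc d * card (KJ (insert j J))" using cB by simp
        then have "2 ^ (Suc d * card J) * card (KJ J) \<le>
            2 ^ (Suc d * card J) * (2 ^ Suc d * card (KJ (insert j J)))"
          by (rule mult_le_mono2)
        also have "\<dots> = 2 ^ (Suc d * card (insert j J)) * card (KJ (insert j J))"
          using False finJ by (simp add: power_add algebra_simps)
        finally have "card K \<le> 2 ^ (Suc d * card (insert j J)) * card (KJ (insert j J))"
          using KKJ by linarith
        moreover have "indep_periods G K H (insert j J)"
        proof (rule indep_periods_insert[OF K sub finJ False _ ind])
          show "el2_group (H i)" if "i \<in> insert j J" for i using that H JA j by blast
          show "K = {a + b |a b. a \<in> K \<inter> (\<Inter>i\<in>J. H i) \<and> b \<in> K \<inter> H j}"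
            using MK by (simp only: M_def KJ_def B_def)
        qed
        ultimately have "good (insert j J)"
          using JA j Js False finJ by (simp add: good_def)
        from max[OF this] show False using False finJ by simp
      qed
      obtain k where k: "card K = 2 ^ k * card M"
        using el2_group_transversal[OF K M MK] by blast
      have "k \<noteq> 0"
      proof
        assume "k = 0"
        then have "M = K" using k MK el2_groupD(1)[OF K] by (intro card_subset_eq) auto
        then show False using \<open>M \<noteq> K\<close> by simp
      qed
      then have "2 * card M \<le> card K" using k by (cases k) auto
      then have "card M \<le> 2 ^ d * card B" using KB by simp
      then have "card (KJ J) * card B \<le> 2 ^ d * card B * card (KJ J \<inter> H j)"
        using prod mult_le_mono1[of "card M" "2 ^ d * card B" "card (KJ J \<inter> H j)"] by simp
      then have "card (KJ J) * card B \<le> (2 ^ d * card (KJ J \<inter> H j)) * card B"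
        by (simp add: ac_simps)
      then show ?thesis using cB by simp
    qed
    show ?thesis
    proof (rule Suc.IH[OF KJ _ _ drop])
      show "KJ J \<subseteq> G" using KJK sub by blast
      have "card G \<le> 2 ^ w * (2 ^ (Suc d * card J) * card (KJ J))"
        using Suc.prems(3) mult_le_mono2[OF KKJ, of "2 ^ w"] by linarith
      also have "\<dots> = 2 ^ (w + Suc d * card J) * card (KJ J)" by (simp add: power_add)
      also have "\<dots> \<le> 2 ^ (w + Suc d * s) * card (KJ J)"
        using cJ by (intro mult_le_mono1 power_increasing add_left_mono mult_le_mono2) auto
      finally show "card G \<le> 2 ^ (w + Suc d * s) * card (KJ J)" .
      show "d \<le> r" using Suc.prems(5) by simp
      have "Suc d * s \<le> r * s" using Suc.prems(5) by (rule mult_le_mono1)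
      then have "w + Suc d * s + e \<le> (w + e) + r * (C * (w + e))" by (simp add: s_def)
      also have "\<dots> = (w + e) * (1 + C * r)" by (simp add: algebra_simps)
      finally have "C * (w + Suc d * s + e) * (1 + C * r) ^ d \<le>
          C * ((w + e) * (1 + C * r)) * (1 + C * r) ^ d"
        by (intro mult_le_mono1 mult_le_mono2)
      also have "\<dots> = C * (w + e) * (1 + C * r) ^ Suc d" by (simp only: power_Suc mult.assoc)
      also have "\<dots> \<le> card A" by (rule Suc.prems(6))
      finally show "C * (w + Suc d * s + e) * (1 + C * r) ^ d \<le> card A" .
    qed
  qed
qed

subsection \<open>Arbitrary quadratic outputs\<close>

text \<open>The squared bias is at most the inverse index of the radical, whence
  \<open>2 * t\<close> dimensions; the extra one pays for passing from the radical to the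
  periods.\<close>

lemma abs_avg_chi_le_of_large_index:
  assumes G: "el2_group G" and g: "quad_on G g"
    and index: "2 ^ (2 * t + 1) * card (periods G g) < card G"
  shows "\<bar>avg G (\<lambda>x. chi (g x))\<bar> \<le> (1/2) ^ t"
proof -
  have "2 ^ (2 * t) * card (radical G g) \<le> 2 ^ (2 * t) * (2 * card (periods G g))"
    using card_radical_le[OF G g] by (rule mult_le_mono2)
  also have "\<dots> = 2 ^ (2 * t + 1) * card (periods G g)" by simp
  also have "\<dots> \<le> card G" using index by (rule less_imp_le)
  finally have "real (2 ^ (2 * t) * card (radical G g)) \<le> real (card G)"
    by (rule of_nat_mono)
  then have "real (card (radical G g)) / real (card G) \<le> 1 / 2 ^ (2 * t)"
    using el2_groupD(5)[OF G] by (simp add: field_simps)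
  then have "(avg G (\<lambda>x. chi (g x)))\<^sup>2 \<le> 1 / 2 ^ (2 * t)"
    using avg_chi_quad_square_le[OF G g] by linarith
  also have "\<dots> = ((1/2) ^ t)\<^sup>2" by (simp add: power_even_eq power_one_over)
  finally show ?thesis using abs_le_square_iff[of _ "(1/2::real) ^ t"] by simp
qed

lemma overlap_law_quadratics_le:
  fixes f :: "nat \<Rightarrow> 'a::ab_group_add \<Rightarrow> bit"
  assumes G: "el2_group G" and quad: "\<And>i. i < n \<Longrightarrow> quad_on G (f i)"
    and C: "2 \<le> C" "\<rho> ^ C \<le> 1/2"
    and n: "2 ^ t * (C * t * (1 + C * (2 * t + 1)) ^ (2 * t + 1)) \<le> n"
  shows "overlap {..<n} (law f {..<n} G) \<le> 2 * \<rho> ^ t"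
proof -
  define low where "low g \<longleftrightarrow> card G \<le> 2 ^ (2 * t + 1) * card (periods G g)" for g
  define F where "F T x = (\<Sum>i\<in>T. f i x)" for T x
  define reg where "reg J \<longleftrightarrow> J \<subseteq> {..<n} \<and> card J \<le> t \<and> (\<forall>T\<subseteq>J. T \<noteq> {} \<longrightarrow> \<not> low (F T))" for J
  have G': "finite G" "G \<noteq> {}" using el2_groupD(1,2)[OF G] by auto
  have quadF: "quad_on G (F T)" if "T \<subseteq> {..<n}" for T
    unfolding F_def using that quad finite_subset by (intro quad_on_sum) auto
  have "reg {}" by (simp add: reg_def)
  moreover have "\<forall>J. reg J \<longrightarrow> card J < Suc t" by (auto simp: reg_def)
  ultimately obtain J where J: "reg J" and max: "\<And>J'. reg J' \<Longrightarrow> card J' \<le> card J"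
    using ex_has_greatest_nat[of reg "{}" card "Suc t"] by auto
  have Jn: "J \<subseteq> {..<n}" and finJ: "finite J" using J finite_subset by (auto simp: reg_def)
  show ?thesis
  proof (cases "card J = t")
    case True
    have "overlap {..<n} (law f {..<n} G) \<le> overlap J (law f J G)"
      by (rule overlap_law_subset[OF _ Jn]) simp
    also have "\<dots> \<le> 2 * \<rho> ^ card J"
    proof (rule overlap_law_le_of_small_bias[OF finJ G'])
      fix T assume T: "T \<subseteq> J" "T \<noteq> {}"
      then have "\<not> low (F T)" using J by (simp add: reg_def)
      then show "\<bar>avg G (\<lambda>x. chi (\<Sum>j\<in>T. f j x))\<bar> \<le> (1/2) ^ card J"
        using abs_avg_chi_le_of_large_index[OF G quadF, of T t] T(1) Jn
        by (simp add: low_def True F_def not_le subset_trans)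
    qed
    finally show ?thesis by (simp add: True)
  next
    case False
    then have Jt: "card J < t" using J by (simp add: reg_def)
    \<comment> \<open>Members of \<open>J\<close> cancel against themselves. For other
      \<open>i\<close>, maximality gives a nonempty \<open>T\<close> inside
      \<open>insert i J\<close> with a \<open>low\<close> sum; it contains \<open>i\<close> because
      \<open>J\<close> is \<open>reg\<close>, and \<open>T - {i}\<close> is the subset
      sought.\<close>
    have "\<exists>T\<subseteq>J. low (\<lambda>x. f i x + F T x)" if i: "i < n" for i
    proof (cases "i \<in> J")
      case True
      have "periods G (\<lambda>x. f i x + F {i} x) = G"
        by (auto simp: periods_def radical_def F_def)
      then show ?thesis using True by (intro exI[of _ "{i}"]) (simp add: low_def)
    next
      case iJ: False
      have "\<not> reg (insert i J)" using max[of "insert i J"] iJ finJ by auto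
      then obtain T where T: "T \<subseteq> insert i J" "T \<noteq> {}" "low (F T)"
        using i Jn Jt iJ finJ by (auto simp: reg_def)
      then have iT: "i \<in> T" using J unfolding reg_def by blast
      have finT: "finite T" using finite_subset[OF T(1)] finJ by simp
      have "F T = (\<lambda>x. f i x + F (T - {i}) x)"
        unfolding F_def by (rule ext) (rule sum.remove[OF finT iT])
      then show ?thesis using T by (intro exI[of _ "T - {i}"]) auto
    qed
    then have "\<forall>i. \<exists>T. i < n \<longrightarrow> T \<subseteq> J \<and> low (\<lambda>x. f i x + F T x)" by blast
    from choice[OF this] obtain \<tau>
      where \<tau>: "\<And>i. i < n \<Longrightarrow> \<tau> i \<subseteq> J \<and> low (\<lambda>x. f i x + F (\<tau> i) x)"
      by blast
    \<comment> \<open>The number of outputs that \<open>overlap_law_le_of_low_index\<close> asks for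
      with \<open>w = 0\<close>, \<open>e = t\<close> and \<open>d = r = 2 * t + 1\<close>.\<close>
    define M where "M = C * t * (1 + C * (2 * t + 1)) ^ (2 * t + 1)"
    have "\<exists>T\<in>Pow J. M \<le> card {i \<in> {..<n}. \<tau> i = T}"
    proof (rule ccontr)
      assume neg: "\<not> (\<exists>T\<in>Pow J. M \<le> card {i \<in> {..<n}. \<tau> i = T})"
      have lt: "card {i \<in> {..<n}. \<tau> i = T} < M" if "T \<in> Pow J" for T
        using neg that by (meson not_le)
      have "(\<Sum>T\<in>Pow J. \<Sum>i\<in>{i \<in> {..<n}. \<tau> i = T}. 1::nat) = (\<Sum>i<n. 1)"
        using \<tau> finJ by (intro sum.group) auto
      then have "n = (\<Sum>T\<in>Pow J. card {i \<in> {..<n}. \<tau> i = T})" by simp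
      also have "\<dots> < (\<Sum>T\<in>Pow J. M)"
        using finJ lt by (intro sum_strict_mono) auto
      also have "\<dots> = 2 ^ card J * M" using finJ by (simp add: card_Pow)
      also have "\<dots> \<le> 2 ^ t * M" using Jt by (intro mult_le_mono1 power_increasing) auto
      finally show False using n by (simp add: M_def)
    qed
    then obtain T where T: "T \<subseteq> J" and M: "M \<le> card {i \<in> {..<n}. \<tau> i = T}" by blast
    define A where "A = {i \<in> {..<n}. \<tau> i = T}"
    have An: "A \<subseteq> {..<n}" and finA: "finite A" by (auto simp: A_def)
    define L where "L i x = f i x + F T x" for i x
    have lowL: "low (L i)" if "i \<in> A" for i
      using \<tau>[of i] that by (auto simp: A_def L_def[abs_def])
    have quadL: "quad_on G (L i)" if "i \<in> A" for i
      unfolding L_def[abs_def] using that An T Jn by (intro quad_on_add quad quadF) auto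
    \<comment> \<open>Stated for both values of the dropped summand: adding a constant to
      \<open>L i\<close> keeps it quadratic and keeps its periods.\<close>
    have bound: "overlap A (law L' A G) \<le> (1/2) ^ t"
      if L': "\<And>i x. L' i x = L i x + c" for L' and c :: bit
    proof (rule overlap_law_le_of_low_index[OF G finA, where H = "\<lambda>i. periods G (L i)"
          and K = G and w = 0 and d = "2 * t + 1" and r = "2 * t + 1"])
      fix i assume i: "i \<in> A"
      show "el2_group (periods G (L i))" by (rule el2_group_periods[OF G quadL[OF i]])
      show "quad_on G (L' i)"
        unfolding L'[abs_def] by (intro quad_on_add quadL i quad_on_const)
      have "G \<inter> periods G (L i) = periods G (L i)" using periods_subset by blast
      then show "card G \<le> 2 ^ (2 * t + 1) * card (G \<inter> periods G (L i))"
        using lowL[OF i] by (simp add: low_def)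
      show "L' i (x + h) = L' i x" if "h \<in> periods G (L i)" "x \<in> G" for h x
        using periods_invariant[OF that] by (simp add: L')
    qed (use G C M in \<open>auto simp: A_def M_def\<close>)
    have "overlap {..<n} (law f {..<n} G) \<le> overlap A (law f A G)"
      by (rule overlap_law_subset[OF _ An]) simp
    also have "overlap A (law f A G) = overlap A (law (\<lambda>i x. F T x + L i x) A G)"
      by (simp add: L_def ac_simps)
    also have "overlap A (law (\<lambda>i x. F T x + L i x) A G) \<le> (1/2) ^ t + (1/2) ^ t"
      using overlap_law_common_summand[of A "F T" L G] bound[of L 0] bound[of "\<lambda>i x. L i x + 1" 1]
      by simp
    also have "\<dots> \<le> \<rho> ^ t + \<rho> ^ t"
      by (intro add_mono power_mono) (simp_all add: \<rho>_def)
    finally show ?thesis by simp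
  qed
qed

subsection \<open>Polynomials on the boolean cube\<close>

text \<open>Passing to \<open>bit\<close> supplies pointwise addition, so that the image of
  \<open>cube m\<close> is the group F_2^m.\<close>

definition bits :: "(nat \<Rightarrow> bool) \<Rightarrow> nat \<Rightarrow> bit" where
  "bits x i = of_bool (x i)"

lemma bij_betw_cube_Pow: "bij_betw Collect (cube n) (Pow {..<n})"
  by (rule bij_betw_byWitness[where f' = "\<lambda>S i. i \<in> S"])
    (auto simp: cube_def not_le[symmetric])

lemma finite_cube: "finite (cube n)" and card_cube: "card (cube n) = 2 ^ n"
  using bij_betw_finite[OF bij_betw_cube_Pow[of n]] bij_betw_same_card[OF bij_betw_cube_Pow[of n]]
  by (simp_all add: card_Pow)

lemma inj_bits: "inj bits"
  by (rule injI, rule ext) (metis bits_def of_bool_eq_iff)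

lemma el2_group_bits_cube: "el2_group (bits ` cube m)"
  unfolding el2_group_def
proof (intro conjI ballI)
  show "finite (bits ` cube m)" using finite_cube by simp
  show "0 \<in> bits ` cube m"
    by (rule image_eqI[of _ _ "\<lambda>_. False"]) (auto simp: bits_def cube_def fun_eq_iff)
  fix u v assume "u \<in> bits ` cube m" "v \<in> bits ` cube m"
  then obtain x y where "u = bits x" "x \<in> cube m" "v = bits y" "y \<in> cube m" by blast
  then show "u + v \<in> bits ` cube m"
    by (intro image_eqI[of _ _ "\<lambda>i. x i \<noteq> y i"]) (auto simp: bits_def cube_def fun_eq_iff)
next
  show "u + u = 0" for u :: "nat \<Rightarrow> bit" by (simp add: fun_eq_iff)
qed

lemma of_nat_bit_eq_1_iff: "(of_nat k :: bit) = 1 \<longleftrightarrow> odd k"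
  by (induction k) auto

lemma quad_on_coord: "quad_on G (\<lambda>v :: nat \<Rightarrow> bit. v i)"
  by (simp add: quad_on_def ac_simps)

lemma quad_on_coord_mult: "quad_on G (\<lambda>v :: nat \<Rightarrow> bit. v i * v j)"
  by (simp add: quad_on_def distrib_left distrib_right ac_simps)

lemma quad_on_cmult: "quad_on G g \<Longrightarrow> quad_on G (\<lambda>x. c * g x)"
  using quad_on_const[of G 0] by (cases c) auto

text \<open>\<open>odd k\<close> says that \<open>k\<close> maps to 1 in \<open>bit\<close>, and
  \<open>of_nat\<close> is a homomorphism of semirings, so the parity becomes the value of the same
  polynomial over F_2.\<close>

lemma quad_eval_bits:
  "\<exists>f. quad_on G f \<and> (\<forall>x. quad_eval m c a b x \<longleftrightarrow> f (bits x) = 1)"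
proof (intro exI conjI allI)
  let ?f = "\<lambda>v. of_bool c + (\<Sum>i<m. of_bool (a i) * v i)
    + (\<Sum>i<m. \<Sum>j\<in>{i<..<m}. of_bool (b i j) * (v i * v j)) :: bit"
  show "quad_on G ?f"
    by (intro quad_on_add quad_on_sum quad_on_const quad_on_cmult quad_on_coord
        quad_on_coord_mult finite_lessThan finite_greaterThanLessThan)
  show "quad_eval m c a b x \<longleftrightarrow> ?f (bits x) = 1" for x
    unfolding quad_eval_def of_nat_bit_eq_1_iff[symmetric] bits_def
    by (simp only: of_nat_add of_nat_sum of_nat_of_bool of_bool_conj of_nat_mult)
qed

text \<open>Both laws have total mass 1, being their own marginals on the empty set of outputs, and
  \<open>\<bar>p - q\<bar> = p + q - 2 * min p q\<close>.\<close>

lemma tv_dist_eq_overlap: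
  assumes f: "\<And>i x. i < n \<Longrightarrow> x \<in> cube m \<Longrightarrow> Q i x \<longleftrightarrow> f i (bits x) = 1"
  shows "tv_dist n (distQ m n Q) (ber13 n) = 1 - overlap {..<n} (law f {..<n} (bits ` cube m))"
proof -
  let ?N = "{..<n}" and ?G = "bits ` cube m"
  let ?p = "law f ?N ?G" and ?q = "ber ?N"
  have G: "finite ?G" "?G \<noteq> {}"
    using el2_groupD(1,2)[OF el2_group_bits_cube] by auto
  have "(\<Sum>S\<in>Pow ?N. ?p S) = 1"
  proof -
    have "law f {} ?G {} = 1" by (simp add: law_def outcome_def avg_const[OF G])
    then show ?thesis using sum_law_fiber[of ?N "{}" "{}" f ?G] by (simp add: Pow_def)
  qed
  moreover have "(\<Sum>S\<in>Pow ?N. ?q S) = 1"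
  proof -
    have "ber {} ({} :: nat set) = 1" by (simp add: ber_def)
    then show ?thesis using sum_ber_fiber[of ?N "{}" "{}"] by (simp add: Pow_def)
  qed
  moreover have "distQ m n Q y = ?p (Collect y)" if y: "y \<in> cube n" for y
  proof -
    have eq: "(\<forall>i<n. Q i x = y i) \<longleftrightarrow> outcome f ?N (bits x) = Collect y" if "x \<in> cube m" for x
      using y f that by (auto simp: outcome_def cube_def not_le[symmetric])
    have "real (card {x \<in> cube m. \<forall>i<n. Q i x = y i}) =
        (\<Sum>x\<in>cube m. of_bool (\<forall>i<n. Q i x = y i))"
      using finite_cube by (simp add: of_bool_def sum.If_cases Int_def)
    also have "\<dots> = (\<Sum>v\<in>?G. of_bool (outcome f ?N v = Collect y))"
      using inj_bits by (simp add: sum.reindex inj_on_subset[OF inj_bits] eq)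
    finally show ?thesis
      using card_image[OF inj_on_subset[OF inj_bits], of "cube m"]
      by (simp add: distQ_def law_def avg_def card_cube)
  qed
  moreover have "ber13 n y = ?q (Collect y)" for y
    by (simp add: ber13_def ber_def)
  ultimately have sums: "(\<Sum>S\<in>Pow ?N. ?p S) = 1" "(\<Sum>S\<in>Pow ?N. ?q S) = 1"
    and tv: "tv_dist n (distQ m n Q) (ber13 n) = 1/2 * (\<Sum>y\<in>cube n. \<bar>?p (Collect y) - ?q (Collect y)\<bar>)"
    by (auto simp: tv_dist_def)
  have "(\<Sum>y\<in>cube n. \<bar>?p (Collect y) - ?q (Collect y)\<bar>) = (\<Sum>S\<in>Pow ?N. \<bar>?p S - ?q S\<bar>)"
    by (rule sum.reindex_bij_betw[OF bij_betw_cube_Pow])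
  also have "\<dots> = (\<Sum>S\<in>Pow ?N. ?p S + ?q S - 2 * min (?p S) (?q S))"
    by (intro sum.cong) (auto simp: min_def)
  also have "\<dots> = 2 - 2 * overlap ?N ?p"
    by (simp add: sum_subtractf sum.distrib sums overlap_def sum_distrib_left)
  finally show ?thesis using tv by simp
qed

theorem theorem9p1:
  shows "\<exists>c::real. c > 0 \<and> (\<exists>N::nat. \<forall>n\<ge>N. \<forall>(m::nat) (Q :: nat \<Rightarrow> (nat \<Rightarrow> bool) \<Rightarrow> bool).
     (\<forall>i<n. deg_le2 m (Q i)) \<longrightarrow>
     tv_dist n (distQ m n Q) (ber13 n) \<ge> 1 - real n powr (- c / log 2 (log 2 (real n))))"
proof -
  have \<rho>: "0 < \<rho>" "\<rho> < 1" by (simp_all add: \<rho>_def)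
  obtain C0 where "\<rho> ^ C0 < 1/2" using real_arch_pow_inv[of "1/2" \<rho>] \<rho> by auto
  moreover define C where "C = max 2 C0"
  moreover have "\<rho> ^ C \<le> \<rho> ^ C0" using \<rho> by (intro power_decreasing) (auto simp: C_def)
  ultimately have C: "2 \<le> C" "\<rho> ^ C \<le> 1/2" by linarith+
  define \<gamma> where "\<gamma> = - log 2 \<rho>"
  have \<gamma>: "0 < \<gamma>" using \<rho> by (simp add: \<gamma>_def log_less_zero_cancel_iff)
  \<comment> \<open>The claimed error is \<open>2 powr (- c * L n)\<close>, while
    \<open>\<rho> ^ t\<close> is \<open>2 powr (- \<gamma> * t)\<close>; hence \<open>t\<close> must
    be of order \<open>L n\<close>.\<close>
  define L where "L n = log 2 (real n) / log 2 (log 2 (real n))" for n :: nat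
  have "filterlim L at_top sequentially" unfolding L_def[abs_def] by real_asymp
  \<comment> \<open>The first threshold gives \<open>4 * C \<le> t\<close> after rounding down. The
    second lets half of the exponent \<open>\<gamma> * L n / 12\<close> absorb the factor 2 and the
    rounding, leaving \<open>\<gamma> / 24\<close>.\<close>
  then have "eventually (\<lambda>n. max (12 * (4 * real C + 1)) (24 * (1 + \<gamma>) / \<gamma>) \<le> L n) sequentially"
    unfolding filterlim_at_top by blast
  moreover have "eventually (\<lambda>n::nat. 1 \<le> log 2 (log 2 (real n))) sequentially" by real_asymp
  moreover have "eventually (\<lambda>n::nat. 2 \<le> n) sequentially" by (rule eventually_ge_at_top)
  ultimately have "eventually (\<lambda>n. max (12 * (4 * real C + 1)) (24 * (1 + \<gamma>) / \<gamma>) \<le> L n \<and>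
      1 \<le> log 2 (log 2 (real n)) \<and> 2 \<le> n) sequentially"
    by eventually_elim simp
  then obtain N where N: "\<And>n. N \<le> n \<Longrightarrow> max (12 * (4 * real C + 1)) (24 * (1 + \<gamma>) / \<gamma>) \<le> L n \<and>
      1 \<le> log 2 (log 2 (real n)) \<and> 2 \<le> n"
    unfolding eventually_sequentially by blast
  have main: "1 - real n powr (- (\<gamma> / 24) / log 2 (log 2 (real n))) \<le> tv_dist n (distQ m n Q) (ber13 n)"
    if n: "N \<le> n" and Q: "\<forall>i<n. deg_le2 m (Q i)" for n m Q
  proof -
    have Ln: "12 * (4 * real C + 1) \<le> L n" "24 * (1 + \<gamma>) / \<gamma> \<le> L n"
      and ll: "1 \<le> log 2 (log 2 (real n))" and n2: "2 \<le> n"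
      using N[OF n] by auto
    define t where "t = nat \<lfloor>L n / 12\<rfloor>"
    have t: "real t \<le> L n / 12" "L n / 12 - 1 \<le> real t"
      using Ln(1) by (simp_all add: t_def) linarith+
    have t4: "4 * C \<le> t"
    proof -
      have "4 * real C \<le> real t" using t(2) Ln(1) by simp
      then show ?thesis by linarith
    qed
    have l1: "1 \<le> log 2 (real n)" using n2 by simp
    \<comment> \<open>Every factor is at most a power of \<open>t\<close>, the base
      \<open>1 + C * (2 * t + 1)\<close> being at most \<open>t * t\<close>, and the total exponent
      \<open>5 * t + 4\<close> is at most \<open>12 * t\<close>. As \<open>t\<close> is at most
      \<open>log 2 (real n)\<close>, the bound \<open>12 * t \<le> L n\<close> gives
      \<open>t ^ (12 * t) \<le> n\<close>.\<close>
    have small: "2 ^ t * (C * t * (1 + C * (2 * t + 1)) ^ (2 * t + 1)) \<le> n"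
    proof -
      have t8: "8 \<le> t" using t4 C(1) by linarith
      have "1 + C * (2 * t + 1) \<le> t * t"
      proof -
        have "1 + C * (2 * t + 1) = 1 + C + 2 * (C * t)" by (simp add: algebra_simps)
        also have "\<dots> \<le> 4 * (C * t)"
        proof -
          have "1 + C \<le> 2 * C" "2 * C \<le> C * t" using C(1) t8 by auto
          then show ?thesis by linarith
        qed
        also have "\<dots> \<le> t * t" using mult_le_mono1[OF t4, of t] by simp
        finally show ?thesis .
      qed
      then have "(1 + C * (2 * t + 1)) ^ (2 * t + 1) \<le> (t * t) ^ (2 * t + 1)"
        by (rule power_mono) simp
      moreover have "C * t \<le> t ^ 2" using t4 by (simp add: power2_eq_square)
      moreover have "2 ^ t \<le> t ^ t" using t8 by (intro power_mono) auto
      ultimately have "2 ^ t * (C * t * (1 + C * (2 * t + 1)) ^ (2 * t + 1)) \<le>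
          t ^ t * (t ^ 2 * (t * t) ^ (2 * t + 1))"
        by (intro mult_le_mono)
      also have "\<dots> = t ^ (t + (2 + 2 * (2 * t + 1)))"
        by (simp only: power_add power_mult power2_eq_square)
      also have "\<dots> \<le> t ^ (12 * t)" using t8 by (intro power_increasing) auto
      finally have le: "2 ^ t * (C * t * (1 + C * (2 * t + 1)) ^ (2 * t + 1)) \<le> t ^ (12 * t)" .
      have "L n \<le> log 2 (real n)"
        using ll l1 by (simp add: L_def divide_le_eq mult_le_cancel_left1)
      then have "real t \<le> log 2 (real n)" using t(1) t8 by simp
      then have "log 2 (real t) \<le> log 2 (log 2 (real n))" using t8 l1 by simp
      then have "real (12 * t) * log 2 (real t) \<le> L n * log 2 (log 2 (real n))"
        using t(1) t8 by (intro mult_mono) auto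
      also have "\<dots> = log 2 (real n)" using ll by (simp add: L_def)
      finally have "log 2 (real t ^ (12 * t)) \<le> log 2 (real n)"
        using t8 by (simp add: log_nat_power)
      then have "real t ^ (12 * t) \<le> real n" using t8 n2 by simp
      then have "t ^ (12 * t) \<le> n" by (metis of_nat_le_iff of_nat_power)
      then show ?thesis using le by linarith
    qed
    let ?G = "bits ` cube m"
    have "\<exists>g. i < n \<longrightarrow> quad_on ?G g \<and> (\<forall>x\<in>cube m. Q i x \<longleftrightarrow> g (bits x) = 1)" for i
    proof (cases "i < n")
      case True
      obtain c a b where "\<forall>x\<in>cube m. Q i x = quad_eval m c a b x"
        using Q True unfolding deg_le2_def by blast
      then show ?thesis using quad_eval_bits[of ?G m c a b] by blast
    qed simp
    then have "\<forall>i. \<exists>g. i < n \<longrightarrow> quad_on ?G g \<and> (\<forall>x\<in>cube m. Q i x \<longleftrightarrow> g (bits x) = 1)"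
      by (rule allI)
    from choice[OF this] obtain f where f: "\<And>i. i < n \<Longrightarrow> quad_on ?G (f i)"
      "\<And>i x. i < n \<Longrightarrow> x \<in> cube m \<Longrightarrow> Q i x \<longleftrightarrow> f i (bits x) = 1"
      by blast
    have "overlap {..<n} (law f {..<n} ?G) \<le> 2 * \<rho> ^ t"
      by (rule overlap_law_quadratics_le[OF el2_group_bits_cube f(1) C small])
    also have "\<rho> ^ t = 2 powr (- \<gamma> * real t)"
      using \<rho> by (simp add: \<gamma>_def powr_powr[symmetric] powr_realpow)
    also have "2 * 2 powr (- \<gamma> * real t) = 2 powr (1 - \<gamma> * real t)"
      by (simp add: powr_diff powr_minus divide_inverse)
    also have "\<dots> \<le> 2 powr (- (\<gamma> / 24) * L n)"
    proof -
      have "\<gamma> * (L n / 12 - 1) \<le> \<gamma> * real t" using t(2) \<gamma> by simp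
      moreover have "24 * (1 + \<gamma>) \<le> \<gamma> * L n" using Ln(2) \<gamma> by (simp add: field_simps)
      ultimately have "1 - \<gamma> * real t \<le> - (\<gamma> / 24) * L n"
        by (simp add: algebra_simps)
      then show ?thesis by simp
    qed
    also have "\<dots> = (2 powr log 2 (real n)) powr (- (\<gamma> / 24) / log 2 (log 2 (real n)))"
      by (simp add: powr_powr L_def mult.commute)
    also have "2 powr log 2 (real n) = real n" using n2 by simp
    finally show ?thesis using tv_dist_eq_overlap[of n m Q f] f(2) by simp
  qed
  show ?thesis
    using \<gamma> main by (intro exI[of _ "\<gamma> / 24"] conjI exI[of _ N]) auto
qed

end
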